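(* Let $(M,g_0,f,\lambda)$ be a gradient Ricci soliton on a closed manifold $M$, let $\xi=\nabla^{g_0}f$, and let $s_0$ be the scalar curvature of $g_0$. If $$\int_M \xi(s_0)\,d\operatorname{vol}_{g_0}\le 0,$$ then $(M,g_0,f,\lambda)$ is an Einstein soliton.
   Context: Closed means compact without boundary. A Ricci soliton $(M,g_0,\xi,\lambda)$ is a Riemannian manifold $(M,g_0)$ with a smooth vector field $\xi$ and a constant $\lambda\in\mathbb{R}$ such that $-\operatorname{Ric}_0=\frac12\mathcal{L}_\xi g_0+\lambda g_0$, where $\operatorname{Ric}_0$ is the Ricci tensor of $g_0$ and $\mathcal{L}_\xi$ is the Lie derivative. A gradient Ricci soliton $(M,g_0,f,\lambda)$ is a smooth complete Riemannian manifold $(M,g_0)$ with $f\in C^\infty(M)$ and $\lambda\in\mathbb{R}$ such that this holds with $\xi=\nabla^{g_0}f$, i.e. $-\operatorname{Ric}_0=\operatorname{Hess}_f+\lambda g_0$. A Ricci soliton is called Einstein if $\mathcal{L}_\xi g_0=0$ (so that $\operatorname{Ric}_0=-\lambda g_0$). *)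

theory Defs
  imports "HOL-Analysis.Analysis"
begin

section \<open>Smooth functions on open subsets of Euclidean space\<close>

definition partial :: "'n::finite \<Rightarrow> (real^'n \<Rightarrow> real) \<Rightarrow> real^'n \<Rightarrow> real" where
  "partial i f x = frechet_derivative f (at x) (axis i 1)"

text \<open>\<open>S\<close> is an open set in all uses below; \<open>Ck_on k S f\<close> says that \<open>f\<close> is of class
  \<open>C\<^sup>k\<close> on \<open>S\<close>.\<close>

primrec Ck_on :: "nat \<Rightarrow> (real^'n::finite) set \<Rightarrow> (real^'n \<Rightarrow> real) \<Rightarrow> bool" where
  "Ck_on 0 S f \<longleftrightarrow> continuous_on S f"
| "Ck_on (Suc k) S f \<longleftrightarrow> (\<forall>x\<in>S. f differentiable (at x)) \<and> (\<forall>i. Ck_on k S (partial i f))"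

definition smooth_on :: "(real^'n::finite) set \<Rightarrow> (real^'n \<Rightarrow> real) \<Rightarrow> bool" where
  "smooth_on S f \<longleftrightarrow> (\<forall>k. Ck_on k S f)"

section \<open>Smooth manifolds\<close>

text \<open>A chart is a domain together with a coordinate map; the values of the map outside
  the domain are irrelevant. The dimension of the manifold is \<open>CARD('n)\<close>.\<close>

type_synonym ('a, 'n) chart = "'a set \<times> ('a \<Rightarrow> real^'n)"

definition chart_dom :: "('a, 'n::finite) chart \<Rightarrow> 'a set" where
  "chart_dom c = fst c"

definition chart_map :: "('a, 'n::finite) chart \<Rightarrow> 'a \<Rightarrow> real^'n" where
  "chart_map c = snd c"

definition chart_img :: "('a, 'n::finite) chart \<Rightarrow> (real^'n) set" where
  "chart_img c = chart_map c ` chart_dom c"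

definition chart_inv :: "('a, 'n::finite) chart \<Rightarrow> real^'n \<Rightarrow> 'a" where
  "chart_inv c = inv_into (chart_dom c) (chart_map c)"

definition transition :: "('a, 'n::finite) chart \<Rightarrow> ('a, 'n) chart \<Rightarrow> real^'n \<Rightarrow> real^'n" where
  "transition c d = chart_map d \<circ> chart_inv c"

definition transition_matrix ::
    "('a, 'n::finite) chart \<Rightarrow> ('a, 'n) chart \<Rightarrow> real^'n \<Rightarrow> real^'n^'n" where
  "transition_matrix c d x = matrix (frechet_derivative (transition c d) (at x))"

text \<open>The manifold is the subspace \<open>M\<close> of an ambient Hausdorff, second countable space, so
  that \<open>M\<close> has these two properties as well; the smooth structure is the one
  generated by the atlas \<open>A\<close>, which need not be maximal. Charts map onto open subsets of
  Euclidean space, so there is no boundary.\<close>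

definition smooth_manifold ::
    "'a::{t2_space,second_countable_topology} set \<Rightarrow> ('a, 'n::finite) chart set \<Rightarrow> bool" where
  "smooth_manifold M A \<longleftrightarrow>
     (\<Union>c\<in>A. chart_dom c) = M \<and>
     (\<forall>c\<in>A. openin (top_of_set M) (chart_dom c) \<and> open (chart_img c) \<and>
        homeomorphism (chart_dom c) (chart_img c) (chart_map c) (chart_inv c)) \<and>
     (\<forall>c\<in>A. \<forall>d\<in>A. \<forall>i.
        smooth_on (chart_map c ` (chart_dom c \<inter> chart_dom d)) (\<lambda>x. transition c d x $ i))"

definition closed_manifold ::
    "'a::{t2_space,second_countable_topology} set \<Rightarrow> ('a, 'n::finite) chart set \<Rightarrow> bool" where
  "closed_manifold M A \<longleftrightarrow> smooth_manifold M A \<and> compact M"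

definition smooth_function :: "('a, 'n::finite) chart set \<Rightarrow> ('a \<Rightarrow> real) \<Rightarrow> bool" where
  "smooth_function A h \<longleftrightarrow> (\<forall>c\<in>A. smooth_on (chart_img c) (h \<circ> chart_inv c))"

section \<open>Vector fields and Riemannian metrics\<close>

text \<open>Tensor fields are given by their components in the charts of the atlas, as functions of
  the coordinates, subject to the tensorial transformation law on overlaps.\<close>

type_synonym ('a, 'n) vfield = "('a, 'n) chart \<Rightarrow> real^'n \<Rightarrow> real^'n"

type_synonym ('a, 'n) tensor2 = "('a, 'n) chart \<Rightarrow> real^'n \<Rightarrow> real^'n^'n"

definition smooth_vector_field :: "('a, 'n::finite) chart set \<Rightarrow> ('a, 'n) vfield \<Rightarrow> bool" where
  "smooth_vector_field A X \<longleftrightarrow>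
     (\<forall>c\<in>A. \<forall>i. smooth_on (chart_img c) (\<lambda>x. X c x $ i)) \<and>
     (\<forall>c\<in>A. \<forall>d\<in>A. \<forall>x \<in> chart_map c ` (chart_dom c \<inter> chart_dom d).
        X d (transition c d x) = transition_matrix c d x *v X c x)"

definition riemannian_metric :: "('a, 'n::finite) chart set \<Rightarrow> ('a, 'n) tensor2 \<Rightarrow> bool" where
  "riemannian_metric A g \<longleftrightarrow>
     (\<forall>c\<in>A. \<forall>i j. smooth_on (chart_img c) (\<lambda>x. g c x $ i $ j)) \<and>
     (\<forall>c\<in>A. \<forall>d\<in>A. \<forall>x \<in> chart_map c ` (chart_dom c \<inter> chart_dom d).
        g c x = transpose (transition_matrix c d x) ** g d (transition c d x) **
                transition_matrix c d x) \<and>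
     (\<forall>c\<in>A. \<forall>x \<in> chart_img c.
        transpose (g c x) = g c x \<and> (\<forall>v. v \<noteq> 0 \<longrightarrow> v \<bullet> (g c x *v v) > 0))"

definition gradient ::
    "('a, 'n::finite) tensor2 \<Rightarrow> ('a \<Rightarrow> real) \<Rightarrow> ('a, 'n) vfield" where
  "gradient g f = (\<lambda>c x. matrix_inv (g c x) *v (\<chi> i. partial i (f \<circ> chart_inv c) x))"

section \<open>Curvature in coordinates\<close>

text \<open>Here \<open>G\<close> is the matrix of metric components in one chart. The Christoffel symbol
  \<open>\<Gamma>\<^sup>k\<^sub>i\<^sub>j\<close> is \<open>christoffel G k i j\<close>, and \<open>\<nabla>\<^sub>i \<partial>\<^sub>j = (\<Sum>k. \<Gamma>\<^sup>k\<^sub>i\<^sub>j \<partial>\<^sub>k)\<close>.\<close>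

definition christoffel ::
    "(real^'n \<Rightarrow> real^'n^'n) \<Rightarrow> 'n::finite \<Rightarrow> 'n \<Rightarrow> 'n \<Rightarrow> real^'n \<Rightarrow> real" where
  "christoffel G k i j x =
     (1/2) * (\<Sum>l\<in>UNIV. matrix_inv (G x) $ k $ l *
        (partial i (\<lambda>y. G y $ j $ l) x + partial j (\<lambda>y. G y $ i $ l) x
         - partial l (\<lambda>y. G y $ i $ j) x))"

text \<open>\<open>curvature G l i j k\<close> is the coefficient of \<open>\<partial>\<^sub>l\<close> in \<open>R(\<partial>\<^sub>i, \<partial>\<^sub>j) \<partial>\<^sub>k\<close>, with
  \<open>R(X, Y) Z = \<nabla>\<^sub>X \<nabla>\<^sub>Y Z - \<nabla>\<^sub>Y \<nabla>\<^sub>X Z - \<nabla>\<^bsub>[X, Y]\<^esub> Z\<close>. The Ricci tensor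
  \<open>Ric(Y, Z)\<close> is the trace of \<open>X \<mapsto> R(X, Y) Z\<close>, which is positive on round spheres.\<close>

definition curvature ::
    "(real^'n \<Rightarrow> real^'n^'n) \<Rightarrow> 'n::finite \<Rightarrow> 'n \<Rightarrow> 'n \<Rightarrow> 'n \<Rightarrow> real^'n \<Rightarrow> real" where
  "curvature G l i j k x =
     partial i (christoffel G l j k) x - partial j (christoffel G l i k) x
     + (\<Sum>m\<in>UNIV. christoffel G m j k x * christoffel G l i m x
                   - christoffel G m i k x * christoffel G l j m x)"

definition ricci :: "(real^'n \<Rightarrow> real^'n^'n) \<Rightarrow> real^'n::finite \<Rightarrow> real^'n^'n" where
  "ricci G x = (\<chi> j k. \<Sum>i\<in>UNIV. curvature G i i j k x)"

definition coord_scalar_curvature ::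
    "(real^'n \<Rightarrow> real^'n^'n) \<Rightarrow> real^'n::finite \<Rightarrow> real" where
  "coord_scalar_curvature G x =
     (\<Sum>j\<in>UNIV. \<Sum>k\<in>UNIV. matrix_inv (G x) $ j $ k * ricci G x $ j $ k)"

definition lie_derivative ::
    "(real^'n \<Rightarrow> real^'n) \<Rightarrow> (real^'n \<Rightarrow> real^'n^'n) \<Rightarrow> real^'n::finite \<Rightarrow> real^'n^'n" where
  "lie_derivative X G x = (\<chi> i j. \<Sum>k\<in>UNIV.
       X x $ k * partial k (\<lambda>y. G y $ i $ j) x
     + G x $ k $ j * partial i (\<lambda>y. X y $ k) x
     + G x $ i $ k * partial j (\<lambda>y. X y $ k) x)"

section \<open>Scalar functions on the manifold\<close>

text \<open>The next two functions on \<open>M\<close> do not depend on the chart used to compute them.\<close>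

definition chart_at :: "('a, 'n::finite) chart set \<Rightarrow> 'a \<Rightarrow> ('a, 'n) chart" where
  "chart_at A p = (SOME c. c \<in> A \<and> p \<in> chart_dom c)"

definition scalar_curvature ::
    "('a, 'n::finite) chart set \<Rightarrow> ('a, 'n) tensor2 \<Rightarrow> 'a \<Rightarrow> real" where
  "scalar_curvature A g p =
     (let c = chart_at A p in coord_scalar_curvature (g c) (chart_map c p))"

definition vf_apply ::
    "('a, 'n::finite) chart set \<Rightarrow> ('a, 'n) vfield \<Rightarrow> ('a \<Rightarrow> real) \<Rightarrow> 'a \<Rightarrow> real" where
  "vf_apply A X h p =
     (let c = chart_at A p; x = chart_map c p
      in \<Sum>i\<in>UNIV. X c x $ i * partial i (h \<circ> chart_inv c) x)"

section \<open>The Riemannian volume measure\<close>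

text \<open>The unique Borel measure on \<open>M\<close> which in every chart is \<open>sqrt (det g) dx\<close>.\<close>

definition riemannian_volume ::
    "'a::{t2_space,second_countable_topology} set \<Rightarrow> ('a, 'n::finite) chart set
      \<Rightarrow> ('a, 'n) tensor2 \<Rightarrow> 'a measure" where
  "riemannian_volume M A g = (THE \<mu>. sets \<mu> = sets (restrict_space borel M) \<and>
     (\<forall>c\<in>A. \<forall>B\<in>sets \<mu>. B \<subseteq> chart_dom c \<longrightarrow>
        emeasure \<mu> B = (\<integral>\<^sup>+x\<in>chart_map c ` B. ennreal (sqrt (det (g c x))) \<partial>lborel)))"

section \<open>Completeness\<close>

text \<open>Geodesics defined on the whole real line, via the second order equation
  \<open>u'' = - \<Gamma>(u', u')\<close> for the coordinate expression \<open>u\<close>; completeness means that every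
  initial point and velocity admits one.\<close>

definition complete_geodesic ::
    "'a::topological_space set \<Rightarrow> ('a, 'n::finite) chart set \<Rightarrow> ('a, 'n) tensor2
      \<Rightarrow> (real \<Rightarrow> 'a) \<Rightarrow> bool" where
  "complete_geodesic M A g \<gamma> \<longleftrightarrow> continuous_on UNIV \<gamma> \<and> range \<gamma> \<subseteq> M \<and>
     (\<forall>c\<in>A. \<forall>t. \<gamma> t \<in> chart_dom c \<longrightarrow>
        (let u = chart_map c \<circ> \<gamma>; u' = (\<lambda>s. vector_derivative u (at s)) in
         u differentiable (at t) \<and>
         (u' has_vector_derivative
            (\<chi> k. - (\<Sum>i\<in>UNIV. \<Sum>j\<in>UNIV. christoffel (g c) k i j (u t) * u' t $ i * u' t $ j)))
           (at t)))"

definition complete_metric ::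
    "'a::topological_space set \<Rightarrow> ('a, 'n::finite) chart set \<Rightarrow> ('a, 'n) tensor2 \<Rightarrow> bool" where
  "complete_metric M A g \<longleftrightarrow>
     (\<forall>c\<in>A. \<forall>p\<in>chart_dom c. \<forall>v. \<exists>\<gamma>. complete_geodesic M A g \<gamma> \<and> \<gamma> 0 = p \<and>
        ((chart_map c \<circ> \<gamma>) has_vector_derivative v) (at 0))"

section \<open>Ricci solitons\<close>

definition ricci_soliton ::
    "'a::{t2_space,second_countable_topology} set \<Rightarrow> ('a, 'n::finite) chart set
      \<Rightarrow> ('a, 'n) tensor2 \<Rightarrow> ('a, 'n) vfield \<Rightarrow> real \<Rightarrow> bool" where
  "ricci_soliton M A g \<xi> lam \<longleftrightarrow>
     smooth_manifold M A \<and> riemannian_metric A g \<and> smooth_vector_field A \<xi> \<and>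
     (\<forall>c\<in>A. \<forall>x\<in>chart_img c.
        - ricci (g c) x = (1/2) *\<^sub>R lie_derivative (\<xi> c) (g c) x + lam *\<^sub>R g c x)"

definition gradient_ricci_soliton ::
    "'a::{t2_space,second_countable_topology} set \<Rightarrow> ('a, 'n::finite) chart set
      \<Rightarrow> ('a, 'n) tensor2 \<Rightarrow> ('a \<Rightarrow> real) \<Rightarrow> real \<Rightarrow> bool" where
  "gradient_ricci_soliton M A g f lam \<longleftrightarrow>
     complete_metric M A g \<and> smooth_function A f \<and> ricci_soliton M A g (gradient g f) lam"

definition einstein_soliton ::
    "'a::{t2_space,second_countable_topology} set \<Rightarrow> ('a, 'n::finite) chart set
      \<Rightarrow> ('a, 'n) tensor2 \<Rightarrow> ('a, 'n) vfield \<Rightarrow> real \<Rightarrow> bool" where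
  "einstein_soliton M A g \<xi> lam \<longleftrightarrow>
     ricci_soliton M A g \<xi> lam \<and>
     (\<forall>c\<in>A. \<forall>x\<in>chart_img c. lie_derivative (\<xi> c) (g c) x = 0)"

end

theory Submission
  imports Defs
begin

text \<open>Let \<open>\<xi> = grad f\<close>, let \<open>u = div \<xi>\<close> and let \<open>n\<close> be the dimension. The trace of the soliton equation
  with respect to the metric says that the scalar curvature is \<open>s = - u - n lam\<close>, because the trace
  of \<open>L\<^sub>\<xi> g\<close> is \<open>2 u\<close>. Hence \<open>\<xi>(s) = - \<xi>(u)\<close>. The divergence of \<open>u \<xi>\<close> is \<open>\<xi>(u) + u\<^sup>2\<close> and integrates
  to zero over the closed manifold, so \<open>\<integral> \<xi>(s) = \<integral> u\<^sup>2\<close>. If this is not positive then \<open>u\<close> vanishes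
  identically. The divergence of \<open>f \<xi>\<close> is then \<open>\<xi>(f) = |\<xi>|\<^sup>2\<close>; it integrates to zero as well, so
  \<open>\<xi> = 0\<close> and the Lie derivative vanishes.

  In coordinates the divergence is \<open>\<Sum>\<^sub>i \<partial>\<^sub>i X\<^sup>i + X(det g) / (2 det g)\<close>, called \<open>coord_divergence\<close>
  below. That it is half the trace of the Lie derivative (\<open>trace_lie_derivative\<close>) is Jacobi's formula
  for the derivative of a determinant, applied to \<open>g\<close>; that it does not depend on the chart
  (\<open>coord_divergence_transition\<close>) is the same formula, applied to the Jacobian matrix of a
  transition map, together with the symmetry of second derivatives.

  The volume measure is given by a definite description, so that nothing can be said about an
  integral before the measure is shown to exist and to be unique (\<open>is_volume_ex1\<close>). A countable
  cover by charts is made disjoint and the coordinate volumes of the pieces are added up; by the change of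
  variables formula all charts assign the same volume to a set in their common domain.

  The divergence theorem (\<open>divergence_theorem\<close>) is reduced by a \<open>C\<^sup>1\<close> partition of unity to functions
  with compact support in one chart. There it says that a partial derivative of a compactly
  supported \<open>C\<^sup>1\<close> function on \<open>\<real>\<^sup>n\<close> has integral zero (\<open>integral_partial_compact_support\<close>), which is
  the translation invariance of Lebesgue measure.\<close>

section \<open>Functions of class \<open>C\<^sup>k\<close> on open sets\<close>

lemma has_derivative_cong_open:
  assumes "open S" "x \<in> S" "\<And>y. y \<in> S \<Longrightarrow> f y = g y"
  shows "(f has_derivative D) (at x) \<longleftrightarrow> (g has_derivative D) (at x)"
  using assms has_derivative_transform_within_open[of f D x UNIV S g]
    has_derivative_transform_within_open[of g D x UNIV S f] by auto

text \<open>Only the germ of a function at a point matters for its partial derivatives. On overlaps of charts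
  this is what allows one coordinate expression to be replaced by another.\<close>

lemma partial_cong:
  assumes "open S" "x \<in> S" "\<And>y. y \<in> S \<Longrightarrow> f y = g y"
  shows "partial i f x = partial i g x"
  unfolding partial_def frechet_derivative_def using has_derivative_cong_open[OF assms] by simp

lemma differentiable_cong_open:
  assumes "open S" "x \<in> S" "\<And>y. y \<in> S \<Longrightarrow> f y = g y"
  shows "f differentiable (at x) \<longleftrightarrow> g differentiable (at x)"
  unfolding differentiable_def using has_derivative_cong_open[OF assms] by simp

text \<open>The functions may differ outside \<open>S\<close>, where coordinate expressions have arbitrary values, so the
  closure properties below compute partial derivatives on \<open>S\<close> only and then pass through this lemma.\<close>

lemma Ck_on_cong:
  assumes "open S" "\<And>y. y \<in> S \<Longrightarrow> f y = g y"
  shows "Ck_on k S f \<longleftrightarrow> Ck_on k S g"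
  using assms(2)
proof (induction k arbitrary: f g)
  case 0
  then show ?case by (simp cong: continuous_on_cong)
next
  case (Suc k)
  have "\<And>i. Ck_on k S (partial i f) = Ck_on k S (partial i g)"
    by (intro Suc.IH partial_cong[OF assms(1)]) (auto intro: Suc.prems)
  moreover have "\<And>x. x \<in> S \<Longrightarrow> f differentiable (at x) \<longleftrightarrow> g differentiable (at x)"
    by (rule differentiable_cong_open[OF assms(1)]) (auto intro: Suc.prems)
  ultimately show ?case by simp
qed

lemma has_derivative_imp_partial: "(f has_derivative D) (at x) \<Longrightarrow> partial i f x = D (axis i 1)"
  unfolding partial_def using frechet_derivative_at by fastforce

lemma linear_eq_sum_axis:
  fixes D :: "real^'n::finite \<Rightarrow> 'b::real_vector"
  assumes "linear D"
  shows "D v = (\<Sum>i\<in>UNIV. v $ i *\<^sub>R D (axis i 1))"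
proof -
  have "v = (\<Sum>i\<in>UNIV. v $ i *\<^sub>R axis i 1)"
    by (simp add: vec_eq_iff axis_def if_distrib cong: if_cong)
  then have "D v = D (\<Sum>i\<in>UNIV. v $ i *\<^sub>R axis i 1)" by simp
  also have "\<dots> = (\<Sum>i\<in>UNIV. v $ i *\<^sub>R D (axis i 1))"
    by (simp add: linear_sum[OF assms] linear_scale[OF assms])
  finally show ?thesis .
qed

lemma differentiable_has_derivative_partial:
  fixes f :: "real^'n::finite \<Rightarrow> real"
  assumes "f differentiable (at x)"
  shows "(f has_derivative (\<lambda>v. \<Sum>i\<in>UNIV. v $ i * partial i f x)) (at x)"
proof -
  obtain D where D: "(f has_derivative D) (at x)" using assms by (auto simp: differentiable_def)
  have "D = (\<lambda>v. \<Sum>i\<in>UNIV. v $ i * partial i f x)"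
  proof
    fix v
    show "D v = (\<Sum>i\<in>UNIV. v $ i * partial i f x)"
      unfolding has_derivative_imp_partial[OF D]
      by (subst linear_eq_sum_axis[OF has_derivative_linear[OF D]]) simp
  qed
  then show ?thesis using D by simp
qed

lemma Ck_on_Suc_D: "Ck_on (Suc k) S f \<Longrightarrow> Ck_on k S f"
proof (induction k arbitrary: f)
  case 0
  then show ?case
    by (auto intro!: continuous_at_imp_continuous_on differentiable_imp_continuous_within)
next
  case (Suc k)
  then show ?case by auto
qed

lemma Ck_on_subset: "Ck_on k S f \<Longrightarrow> T \<subseteq> S \<Longrightarrow> Ck_on k T f"
  by (induction k arbitrary: f) (auto intro: continuous_on_subset)

lemma Ck_on_open_local:
  assumes "\<And>x. x \<in> S \<Longrightarrow> \<exists>T. open T \<and> x \<in> T \<and> Ck_on k T f"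
  shows "Ck_on k S f"
  using assms
proof (induction k arbitrary: f)
  case 0
  then have "\<forall>x\<in>S. isCont f x"
    by (metis Ck_on.simps(1) continuous_on_eq_continuous_at)
  then show ?case by (simp add: continuous_at_imp_continuous_on)
next
  case (Suc k)
  have "f differentiable (at x)" if "x \<in> S" for x
    using Suc.prems[OF that] by auto
  moreover have "Ck_on k S (partial i f)" for i
  proof (rule Suc.IH)
    fix x assume "x \<in> S"
    from Suc.prems[OF this] show "\<exists>T. open T \<and> x \<in> T \<and> Ck_on k T (partial i f)" by auto
  qed
  ultimately show ?case by simp
qed

lemma partial_const [simp]: "partial i (\<lambda>x. c) x = 0"
  by (simp add: partial_def)

lemma Ck_on_const [simp]:
  fixes S :: "(real^'n::finite) set"
  shows "Ck_on k S (\<lambda>x. c)"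
proof (induction k arbitrary: c)
  case (Suc k)
  have "partial i (\<lambda>x. c) = (\<lambda>x. 0)" for i :: 'n by (simp add: fun_eq_iff)
  then show ?case using Suc by simp
qed simp

lemma partial_add:
  assumes "f differentiable (at x)" "g differentiable (at x)"
  shows "partial i (\<lambda>x. f x + g x) x = partial i f x + partial i g x"
  using has_derivative_imp_partial[OF has_derivative_add[OF
      assms(1)[unfolded frechet_derivative_works] assms(2)[unfolded frechet_derivative_works]]]
  by (simp add: partial_def)

lemma partial_mult:
  assumes "f differentiable (at x)" "g differentiable (at x)"
  shows "partial i (\<lambda>x. f x * g x) x = f x * partial i g x + partial i f x * g x"
  using has_derivative_imp_partial[OF has_derivative_mult[OF
      assms(1)[unfolded frechet_derivative_works] assms(2)[unfolded frechet_derivative_works]]]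
  by (simp add: partial_def)

lemma partial_inverse:
  assumes "f differentiable (at x)" "f x \<noteq> 0"
  shows "partial i (\<lambda>x. inverse (f x)) x = - 1 * (partial i f x * (inverse (f x) * inverse (f x)))"
  using has_derivative_imp_partial[OF Deriv.has_derivative_inverse[OF
      assms(2) assms(1)[unfolded frechet_derivative_works]]]
  by (simp add: partial_def)

lemma partial_sum:
  assumes "\<And>a. a \<in> I \<Longrightarrow> f a differentiable (at x)"
  shows "partial i (\<lambda>x. \<Sum>a\<in>I. f a x) x = (\<Sum>a\<in>I. partial i (f a) x)"
proof -
  have "((\<lambda>x. \<Sum>a\<in>I. f a x) has_derivative (\<lambda>v. \<Sum>a\<in>I. frechet_derivative (f a) (at x) v)) (at x)"
    by (rule has_derivative_sum) (use assms frechet_derivative_works in blast)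
  from has_derivative_imp_partial[OF this] show ?thesis by (simp add: partial_def)
qed

lemma Ck_on_add:
  "open S \<Longrightarrow> Ck_on k S f \<Longrightarrow> Ck_on k S g \<Longrightarrow> Ck_on k S (\<lambda>x. f x + g x)"
proof (induction k arbitrary: f g)
  case 0
  then show ?case by (simp add: continuous_on_add)
next
  case (Suc k)
  have "Ck_on k S (partial i (\<lambda>x. f x + g x))" for i
  proof -
    have "Ck_on k S (\<lambda>x. partial i f x + partial i g x)" using Suc by auto
    then show ?thesis using Suc.prems by (subst Ck_on_cong[OF Suc.prems(1)]) (auto simp: partial_add)
  qed
  then show ?case using Suc.prems by (auto intro: differentiable_add)
qed

lemma Ck_on_mult:
  "open S \<Longrightarrow> Ck_on k S f \<Longrightarrow> Ck_on k S g \<Longrightarrow> Ck_on k S (\<lambda>x. f x * g x)"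
proof (induction k arbitrary: f g)
  case 0
  then show ?case by (simp add: continuous_on_mult)
next
  case (Suc k)
  have "Ck_on k S (partial i (\<lambda>x. f x * g x))" for i
  proof -
    have "Ck_on k S (\<lambda>x. f x * partial i g x + partial i f x * g x)"
      using Suc.prems Ck_on_Suc_D[OF Suc.prems(2)] Ck_on_Suc_D[OF Suc.prems(3)]
      by (auto intro!: Ck_on_add Suc.IH)
    then show ?thesis using Suc.prems by (subst Ck_on_cong[OF Suc.prems(1)]) (auto simp: partial_mult)
  qed
  then show ?case using Suc.prems by (auto intro: differentiable_mult)
qed

lemma Ck_on_inverse:
  "open S \<Longrightarrow> (\<forall>x\<in>S. f x \<noteq> 0) \<Longrightarrow> Ck_on k S f \<Longrightarrow> Ck_on k S (\<lambda>x. inverse (f x))"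
proof (induction k)
  case 0
  then show ?case by (simp add: continuous_on_inverse)
next
  case (Suc k)
  have "Ck_on k S (partial i (\<lambda>x. inverse (f x)))" for i
  proof -
    have "Ck_on k S (\<lambda>x. inverse (f x))" using Suc.IH Suc.prems Ck_on_Suc_D by blast
    then have "Ck_on k S (\<lambda>x. - 1 * (partial i f x * (inverse (f x) * inverse (f x))))"
      using Suc.prems by (intro Ck_on_mult Ck_on_const) auto
    then show ?thesis
      using Suc.prems by (subst Ck_on_cong[OF Suc.prems(1) partial_inverse]) auto
  qed
  then show ?case using Suc.prems by (auto intro!: differentiable_inverse)
qed

lemma Ck_on_sum:
  "open S \<Longrightarrow> (\<And>a. a \<in> I \<Longrightarrow> Ck_on k S (f a)) \<Longrightarrow> Ck_on k S (\<lambda>x. \<Sum>a\<in>I. f a x)"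
  by (induction I rule: infinite_finite_induct) (auto intro!: Ck_on_add)

lemma Ck_on_prod:
  "open S \<Longrightarrow> (\<And>a. a \<in> I \<Longrightarrow> Ck_on k S (f a)) \<Longrightarrow> Ck_on k S (\<lambda>x. \<Prod>a\<in>I. f a x)"
  by (induction I rule: infinite_finite_induct) (auto intro!: Ck_on_mult)

lemma Ck_on_divide:
  "open S \<Longrightarrow> (\<forall>x\<in>S. g x \<noteq> 0) \<Longrightarrow> Ck_on k S f \<Longrightarrow> Ck_on k S g \<Longrightarrow> Ck_on k S (\<lambda>x. f x / g x)"
  unfolding divide_inverse by (intro Ck_on_mult Ck_on_inverse)

lemma Ck_on_det:
  fixes G :: "real^'n::finite \<Rightarrow> real^'m::finite^'m"
  assumes "open S" "\<And>i j. Ck_on k S (\<lambda>x. G x $ i $ j)"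
  shows "Ck_on k S (\<lambda>x. det (G x))"
  unfolding det_def by (intro Ck_on_sum Ck_on_mult Ck_on_prod Ck_on_const assms)

lemma has_derivative_vec_partial:
  fixes t :: "real^'n::finite \<Rightarrow> real^'m::finite"
  assumes "\<And>j. (\<lambda>x. t x $ j) differentiable (at x)"
  shows "(t has_derivative (\<lambda>v. \<chi> j. \<Sum>i\<in>UNIV. v $ i * partial i (\<lambda>x. t x $ j) x)) (at x)"
proof -
  have "((\<lambda>x. t x \<bullet> b) has_derivative
      (\<lambda>v. (\<chi> j. \<Sum>i\<in>UNIV. v $ i * partial i (\<lambda>x. t x $ j) x) \<bullet> b)) (at x)" if "b \<in> Basis" for b
  proof -
    from that obtain j where b: "b = axis j 1" by (auto simp: Basis_vec_def)
    show ?thesis unfolding b inner_axis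
      using differentiable_has_derivative_partial[OF assms[of j]] by simp
  qed
  then show ?thesis by (subst has_derivative_componentwise_within) blast
qed

lemma partial_compose:
  fixes f :: "real^'m::finite \<Rightarrow> real" and t :: "real^'n::finite \<Rightarrow> real^'m"
  assumes t: "\<And>j. (\<lambda>x. t x $ j) differentiable (at x)" and f: "f differentiable (at (t x))"
  shows "partial i (\<lambda>x. f (t x)) x = (\<Sum>j\<in>UNIV. partial j f (t x) * partial i (\<lambda>x. t x $ j) x)"
proof -
  have "((\<lambda>x. f (t x)) has_derivative (\<lambda>v. \<Sum>j\<in>UNIV. (\<Sum>i\<in>UNIV. v $ i * partial i (\<lambda>x. t x $ j) x) * partial j f (t x))) (at x)"
    using has_derivative_compose[OF has_derivative_vec_partial[of t x, OF t] differentiable_has_derivative_partial[OF f]]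
    by simp
  from has_derivative_imp_partial[OF this, of i] show ?thesis
    by (simp add: axis_def if_distrib if_distribR mult.commute cong: if_cong)
qed

text \<open>Induction on \<open>k\<close>: by the chain rule each partial derivative is a sum of products of functions of
  class \<open>C\<^sup>k\<close>, the factor \<open>partial j f (t x)\<close> being one by the induction hypothesis.\<close>

lemma Ck_on_compose:
  fixes f :: "real^'m::finite \<Rightarrow> real" and t :: "real^'n::finite \<Rightarrow> real^'m"
  assumes "open S" "\<And>j. Ck_on k S (\<lambda>x. t x $ j)" "\<And>x. x \<in> S \<Longrightarrow> t x \<in> T" "Ck_on k T f"
  shows "Ck_on k S (\<lambda>x. f (t x))"
  using assms(2,4)
proof (induction k arbitrary: f)
  case 0
  have "continuous_on S t"
    using continuous_on_vec_lambda[of S "\<lambda>j x. t x $ j"] 0 by auto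
  then show ?case using 0 assms(3) by (auto intro!: continuous_on_compose2[of T f S t])
next
  case (Suc k)
  have "Ck_on k S (partial i (\<lambda>x. f (t x)))" for i
  proof -
    have "Ck_on k S (\<lambda>x. \<Sum>j\<in>UNIV. partial j f (t x) * partial i (\<lambda>x. t x $ j) x)"
    proof (intro Ck_on_sum Ck_on_mult assms(1))
      fix j
      show "Ck_on k S (\<lambda>x. partial j f (t x))"
        by (rule Suc.IH) (use Suc.prems(2) Ck_on_Suc_D[OF Suc.prems(1)] in auto)
      show "Ck_on k S (partial i (\<lambda>x. t x $ j))" using Suc.prems(1)[of j] by simp
    qed
    then show ?thesis using Suc.prems assms(3)
      by (subst Ck_on_cong[OF assms(1) partial_compose]) auto
  qed
  moreover have "(\<lambda>x. f (t x)) differentiable (at x)" if "x \<in> S" for x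
  proof -
    have "t differentiable (at x)"
      using has_derivative_vec_partial[of t x] Suc.prems that by (auto simp: differentiable_def)
    then show ?thesis
      using Suc.prems assms(3)[OF that] differentiable_chain_at[of t x f] by (auto simp: o_def)
  qed
  ultimately show ?case by simp
qed

lemma Ck_on_sqrt:
  "open S \<Longrightarrow> (\<forall>x\<in>S. f x > 0) \<Longrightarrow> Ck_on k S f \<Longrightarrow> Ck_on k S (\<lambda>x. sqrt (f x))"
proof (induction k)
  case 0
  then show ?case by (simp add: continuous_on_real_sqrt)
next
  case (Suc k)
  have D: "((\<lambda>x. sqrt (f x)) has_derivative (\<lambda>v. frechet_derivative f (at x) v * (inverse (sqrt (f x)) / 2))) (at x)"
    if "x \<in> S" for x
  proof -
    have "(f has_derivative frechet_derivative f (at x)) (at x)"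
      using Suc.prems(3) that frechet_derivative_works by auto
    then show ?thesis using Suc.prems(2) that by (intro has_derivative_real_sqrt) auto
  qed
  have "Ck_on k S (partial i (\<lambda>x. sqrt (f x)))" for i
  proof -
    have "Ck_on k S (\<lambda>x. sqrt (f x))" using Suc.IH Suc.prems Ck_on_Suc_D by blast
    then have "Ck_on k S (\<lambda>x. partial i f x * (inverse (sqrt (f x)) * (1 / 2)))"
      using Suc.prems by (intro Ck_on_mult Ck_on_const Ck_on_inverse) auto
    then show ?thesis
      by (rule iffD2[OF Ck_on_cong[OF Suc.prems(1)], rotated])
        (simp add: has_derivative_imp_partial[OF D], simp add: partial_def)
  qed
  moreover have "\<forall>x\<in>S. (\<lambda>x. sqrt (f x)) differentiable (at x)"
    using D differentiable_def by blast
  ultimately show ?case by simp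
qed

lemma Ck_on_component: "Ck_on k S (\<lambda>x::real^'n::finite. x $ i)"
proof (cases k)
  case 0
  then show ?thesis by (simp add: continuous_on_component)
next
  case (Suc m)
  have d: "((\<lambda>x::real^'n. x $ i) has_derivative (\<lambda>v. v $ i)) (at x)" for x
    by (rule bounded_linear_imp_has_derivative[OF bounded_linear_vec_nth])
  have "partial j (\<lambda>x::real^'n. x $ i) = (\<lambda>x. axis j 1 $ i)" for j
    using has_derivative_imp_partial[OF d] by blast
  moreover have "(\<lambda>x::real^'n. x $ i) differentiable (at x)" for x
    using d differentiable_def by blast
  ultimately show ?thesis using Suc by simp
qed

text \<open>A compactly supported function on a chart image becomes a function on the whole space. The two
  open sets \<open>V\<close> and \<open>- K\<close> cover the space, and the function is of class \<open>C\<^sup>k\<close> on each.\<close>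

lemma Ck_on_extend_by_zero:
  fixes F :: "real^'n::finite \<Rightarrow> real"
  assumes V: "open V" and K: "compact K" "K \<subseteq> V" and F: "Ck_on k V F" "\<And>x. x \<notin> K \<Longrightarrow> F x = 0"
  shows "Ck_on k UNIV F"
proof (rule Ck_on_open_local)
  fix x
  have oK: "open (- K)" using K(1) by (simp add: compact_imp_closed open_Compl)
  have "Ck_on k (- K) F"
    by (rule iffD2[OF Ck_on_cong[OF oK] Ck_on_const[of k "- K" 0]]) (use F in auto)
  then show "\<exists>T. open T \<and> x \<in> T \<and> Ck_on k T F"
    using F(1) V K(2) oK by (cases "x \<in> V") blast+
qed

lemma partial_along_axis:
  fixes f :: "real^'n::finite \<Rightarrow> real"
  assumes "f differentiable (at (y + s *\<^sub>R axis i 1))"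
  shows "((\<lambda>s. f (y + s *\<^sub>R axis i 1)) has_real_derivative partial i f (y + s *\<^sub>R axis i 1)) (at s)"
proof -
  have 1: "((\<lambda>s. y + s *\<^sub>R axis i 1) has_derivative (\<lambda>h. h *\<^sub>R axis i (1::real))) (at s)"
    by (auto intro!: derivative_eq_intros)
  have "((\<lambda>s. f (y + s *\<^sub>R axis i 1)) has_derivative (\<lambda>h. h * partial i f (y + s *\<^sub>R axis i 1))) (at s)"
    using has_derivative_compose[OF 1 differentiable_has_derivative_partial[OF assms]]
    by (simp add: axis_def if_distrib if_distribR cong: if_cong)
  then show ?thesis
    by (simp add: has_field_derivative_def mult.commute[of _ "partial i f _"] cong: if_cong)
qed

text \<open>The mean value theorem, applied first in direction \<open>i\<close> and then in direction \<open>j\<close>. The second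
  difference on the left is symmetric in \<open>i\<close> and \<open>j\<close>, which is the source of Clairaut's theorem.\<close>

lemma second_difference_mean_value:
  fixes f :: "real^'n::finite \<Rightarrow> real"
  assumes C: "Ck_on 2 (ball x (3*h)) f" and h: "h > 0"
  obtains y where "y \<in> ball x (3*h)"
    "f (x + h *\<^sub>R axis i 1 + h *\<^sub>R axis j 1) - f (x + h *\<^sub>R axis i 1) - f (x + h *\<^sub>R axis j 1) + f x
      = h * h * partial j (partial i f) y"
proof -
  let ?e = "\<lambda>i. axis i 1 :: real^'n"
  have inb: "x + s *\<^sub>R ?e i + t *\<^sub>R ?e j \<in> ball x (3*h)" if "0 \<le> s" "s \<le> h" "0 \<le> t" "t \<le> h" for s t i j
  proof -
    have "norm (s *\<^sub>R ?e i + t *\<^sub>R ?e j) \<le> s + t"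
      using norm_triangle_ineq[of "s *\<^sub>R ?e i" "t *\<^sub>R ?e j"] that by simp
    also have "\<dots> < 3 * h" using that h by simp
    finally show ?thesis
      by (metis add.assoc add_diff_cancel_left' dist_commute dist_norm mem_ball)
  qed
  have d1: "f differentiable (at y)" if "y \<in> ball x (3*h)" for y
    using C that by (simp add: numeral_2_eq_2)
  have d2: "partial i f differentiable (at y)" if "y \<in> ball x (3*h)" for y i
    using C that by (simp add: numeral_2_eq_2)
  let ?u = "\<lambda>s. f ((x + h *\<^sub>R ?e j) + s *\<^sub>R ?e i) - f (x + s *\<^sub>R ?e i)"
  have "(?u has_real_derivative (partial i f ((x + h *\<^sub>R ?e j) + s *\<^sub>R ?e i) - partial i f (x + s *\<^sub>R ?e i))) (at s)"
    if "0 \<le> s" "s \<le> h" for s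
    using inb[of h s j i] inb[of s 0 i i] that h
    by (intro DERIV_diff partial_along_axis d1) (auto)
  from MVT2[OF h this] obtain s where s: "0 < s" "s < h"
    and u: "?u h - ?u 0 = h * (partial i f ((x + h *\<^sub>R ?e j) + s *\<^sub>R ?e i) - partial i f (x + s *\<^sub>R ?e i))"
    by auto
  let ?v = "\<lambda>t. partial i f ((x + s *\<^sub>R ?e i) + t *\<^sub>R ?e j)"
  have "(?v has_real_derivative (partial j (partial i f) ((x + s *\<^sub>R ?e i) + t *\<^sub>R ?e j))) (at t)"
    if "0 \<le> t" "t \<le> h" for t
    using inb[of s t i j] that s by (intro partial_along_axis d2) auto
  from MVT2[OF h this] obtain t where t: "0 < t" "t < h"
    and v: "?v h - ?v 0 = h * partial j (partial i f) ((x + s *\<^sub>R ?e i) + t *\<^sub>R ?e j)" by auto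
  show ?thesis
  proof (rule that)
    show "x + s *\<^sub>R ?e i + t *\<^sub>R ?e j \<in> ball x (3*h)" using inb s t by simp
    show "f (x + h *\<^sub>R axis i 1 + h *\<^sub>R axis j 1) - f (x + h *\<^sub>R axis i 1) - f (x + h *\<^sub>R axis j 1) + f x
      = h * h * partial j (partial i f) (x + s *\<^sub>R ?e i + t *\<^sub>R ?e j)"
      using u v by (simp add: algebra_simps)
  qed
qed

text \<open>Clairaut's theorem. Both mixed derivatives, at suitable points near \<open>x\<close>, equal the same second
  difference divided by \<open>h\<^sup>2\<close>, and both are continuous.\<close>

lemma partial_commute:
  fixes f :: "real^'n::finite \<Rightarrow> real"
  assumes "Ck_on 2 S f" "open S" "x \<in> S"
  shows "partial i (partial j f) x = partial j (partial i f) x"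
proof (rule ccontr)
  let ?a = "partial i (partial j f)" and ?b = "partial j (partial i f)"
  assume ne: "?a x \<noteq> ?b x"
  define e where "e = \<bar>?a x - ?b x\<bar> / 2"
  have e: "e > 0" using ne by (simp add: e_def)
  have "continuous_on S ?a" "continuous_on S ?b" using assms by (auto simp: numeral_2_eq_2)
  then have "isCont ?a x" "isCont ?b x" using assms continuous_on_eq_continuous_at by blast+
  then obtain d1 d2 where d: "d1 > 0" "d2 > 0"
    "\<And>y. dist y x < d1 \<Longrightarrow> dist (?a y) (?a x) < e" "\<And>y. dist y x < d2 \<Longrightarrow> dist (?b y) (?b x) < e"
    using e unfolding continuous_at_eps_delta by metis
  obtain r where r: "r > 0" "ball x r \<subseteq> S" using assms openE by blast
  define h where "h = min r (min d1 d2) / 3"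
  have h: "h > 0" "3*h \<le> r" "3*h \<le> d1" "3*h \<le> d2" using r d by (auto simp: h_def)
  have C: "Ck_on 2 (ball x (3*h)) f"
    by (rule Ck_on_subset[OF assms(1)]) (use r h in auto)
  obtain y where y: "y \<in> ball x (3*h)" "f (x + h *\<^sub>R axis i 1 + h *\<^sub>R axis j 1) - f (x + h *\<^sub>R axis i 1) - f (x + h *\<^sub>R axis j 1) + f x
      = h * h * ?b y" using second_difference_mean_value[OF C h(1)] by metis
  obtain z where z: "z \<in> ball x (3*h)" "f (x + h *\<^sub>R axis j 1 + h *\<^sub>R axis i 1) - f (x + h *\<^sub>R axis j 1) - f (x + h *\<^sub>R axis i 1) + f x
      = h * h * ?a z" using second_difference_mean_value[OF C h(1)] by metis
  have "h * h * ?b y = h * h * ?a z" using y(2) z(2) by (simp add: algebra_simps)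
  then have "?b y = ?a z" using h by simp
  moreover have "dist (?a z) (?a x) < e" "dist (?b y) (?b x) < e"
    using d(3)[of z] d(4)[of y] h y(1) z(1) by (simp_all add: dist_commute)
  moreover have False if "p = q" "dist q r < \<bar>r - s\<bar> / 2" "dist p s < \<bar>r - s\<bar> / 2" for p q r s :: real
    using that unfolding dist_real_def by (simp add: abs_if split: if_splits)
  ultimately show False unfolding e_def by blast
qed

section \<open>Derivatives of determinants and the trace of the Lie derivative\<close>

lemma matrix_inv_inverse:
  fixes A :: "real^'n::finite^'n"
  assumes "invertible A"
  shows "A ** matrix_inv A = mat 1" "matrix_inv A ** A = mat 1"
  using someI_ex[OF assms[unfolded invertible_def]] by (auto simp: matrix_inv_def)

lemma transpose_matrix_inv_symmetric:
  fixes A :: "real^'n::finite^'n"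
  assumes "invertible A" "transpose A = A"
  shows "transpose (matrix_inv A) = matrix_inv A"
proof -
  have "transpose (matrix_inv A) ** A = mat 1"
    using arg_cong[OF matrix_inv_inverse(1)[OF assms(1)], of transpose] assms(2)
    by (simp add: matrix_transpose_mul transpose_mat)
  then have "transpose (matrix_inv A) ** (A ** matrix_inv A) = matrix_inv A"
    by (simp add: matrix_mul_assoc)
  then show ?thesis by (simp add: matrix_inv_inverse[OF assms(1)])
qed

lemma posdef_invertible:
  fixes G :: "real^'n::finite^'n"
  assumes "\<And>v. v \<noteq> 0 \<Longrightarrow> v \<bullet> (G *v v) > 0"
  shows "invertible G"
proof -
  have "\<forall>v. G *v v = 0 \<longrightarrow> v = 0" using assms by (metis inner_zero_right less_irrefl)
  then show ?thesis by (simp add: invertible_left_inverse matrix_left_invertible_ker)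
qed

text \<open>The segment from the identity matrix to \<open>G\<close> consists of positive definite, hence invertible,
  matrices, so the determinant cannot change sign along it.\<close>

lemma posdef_det_pos:
  fixes G :: "real^'n::finite^'n"
  assumes pos: "\<And>v. v \<noteq> 0 \<Longrightarrow> v \<bullet> (G *v v) > 0"
  shows "det G > 0"
proof (rule ccontr)
  assume neg: "\<not> det G > 0"
  define K where "K t = (1 - t) *\<^sub>R mat 1 + t *\<^sub>R G" for t
  have inv: "det (K t) \<noteq> 0" if "0 \<le> t" "t \<le> 1" for t
  proof -
    have "v \<bullet> (K t *v v) > 0" if v: "v \<noteq> 0" for v
    proof -
      have "v \<bullet> (K t *v v) = (1 - t) * (v \<bullet> v) + t * (v \<bullet> (G *v v))"
        by (simp add: K_def matrix_vector_mult_add_rdistrib scaleR_matrix_vector_assoc[symmetric]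
            inner_add_right)
      also have "\<dots> > 0"
      proof (cases "t = 1")
        case False
        then have "(1 - t) * (v \<bullet> v) > 0" using that \<open>t \<le> 1\<close> v by simp
        moreover have "t * (v \<bullet> (G *v v)) \<ge> 0" using pos[OF v] \<open>0 \<le> t\<close> by simp
        ultimately show ?thesis by simp
      qed (use pos[OF v] in simp)
      finally show ?thesis .
    qed
    then show ?thesis using posdef_invertible invertible_det_nz by blast
  qed
  have "continuous_on {0..1} (\<lambda>t. det (K t))"
    unfolding det_def K_def by (intro continuous_intros)
  moreover have "det (K 0) = 1" "det (K 1) = det G" by (auto simp: K_def)
  ultimately obtain t where "0 \<le> t" "t \<le> 1" "det (K t) = 0"
    using IVT2'[of "\<lambda>t. det (K t)" 1 0 0] neg by auto
  then show False using inv by blast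
qed

text \<open>In the Leibniz expansion only the identity permutation contributes: any other permutation moves at
  least two indices, so after one factor is differentiated an off-diagonal entry of the
  identity matrix is left over.\<close>

lemma det_has_derivative_identity:
  "(det has_derivative trace) (at (mat 1 :: real^'n::finite^'n))"
proof -
  let ?P = "{p. p permutes (UNIV :: 'n set)}"
  let ?I = "mat 1 :: real^'n^'n"
  let ?D = "\<lambda>H::real^'n^'n. \<Sum>p\<in>?P. of_int (sign p) * (\<Sum>i\<in>UNIV. H $ i $ p i * (\<Prod>j\<in>UNIV - {i}. ?I $ j $ p j))"
  have comp: "((\<lambda>X::real^'n^'n. X $ i $ j) has_derivative (\<lambda>H. H $ i $ j)) (at ?I)" for i j
    by (intro bounded_linear_imp_has_derivative bounded_linear_compose[OF bounded_linear_vec_nth bounded_linear_vec_nth])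
  have "((\<lambda>X::real^'n^'n. \<Sum>p\<in>?P. of_int (sign p) * (\<Prod>i\<in>UNIV. X $ i $ p i)) has_derivative ?D) (at ?I)"
    by (intro has_derivative_sum has_derivative_mult_right has_derivative_prod comp)
  moreover have "?D H = trace H" for H
  proof -
    have "(\<Sum>i\<in>UNIV. H $ i $ p i * (\<Prod>j\<in>UNIV - {i}. ?I $ j $ p j)) = 0" if p: "p \<in> ?P" "p \<noteq> id" for p
    proof (rule sum.neutral, intro ballI)
      fix i :: 'n
      have "\<exists>j. j \<noteq> i \<and> p j \<noteq> j"
      proof (rule ccontr)
        assume *: "\<not> ?thesis"
        have "inj p" using p by (simp add: permutes_inj)
        have "p i = i"
        proof (rule ccontr)
          assume "p i \<noteq> i"
          with * have "p (p i) = p i" by blast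
          with \<open>inj p\<close> \<open>p i \<noteq> i\<close> show False by (auto dest: injD)
        qed
        with * have "p = id" by (metis eq_id_iff)
        with p show False by simp
      qed
      then obtain j where "j \<noteq> i" "p j \<noteq> j" by blast
      then have "(\<Prod>j\<in>UNIV - {i}. ?I $ j $ p j) = 0"
        by (intro prod_zero) (auto simp: mat_def intro!: bexI[of _ j])
      then show "H $ i $ p i * (\<Prod>j\<in>UNIV - {i}. ?I $ j $ p j) = 0" by simp
    qed
    then have "?D H = (\<Sum>p\<in>{id}. of_int (sign p) * (\<Sum>i\<in>UNIV. H $ i $ p i * (\<Prod>j\<in>UNIV - {i}. ?I $ j $ p j)))"
      by (intro sum.mono_neutral_right) (auto simp: finite_permutations permutes_id)
    also have "\<dots> = trace H" by (simp add: trace_def mat_def)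
    finally show ?thesis .
  qed
  ultimately show ?thesis by (simp add: det_def[abs_def])
qed

text \<open>Jacobi's formula at a general point follows from the one at the identity by writing
  \<open>det X = det G * det (G\<^sup>-\<^sup>1 X)\<close>.\<close>

lemma det_has_derivative:
  fixes G :: "real^'n::finite^'n"
  assumes "invertible G"
  shows "(det has_derivative (\<lambda>H. det G * trace (matrix_inv G ** H))) (at G)"
proof -
  let ?N = "matrix_inv G"
  have "linear (\<lambda>X::real^'n^'n. ?N ** X)"
    by (rule linearI) (simp_all add: matrix_add_ldistrib vec_eq_iff matrix_matrix_mult_def sum_distrib_left distrib_left
        sum.distrib mult.left_commute)
  then have 1: "((\<lambda>X. ?N ** X) has_derivative (\<lambda>X. ?N ** X)) (at G)"
    by (simp add: linear_conv_bounded_linear bounded_linear_imp_has_derivative)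
  have 2: "(det has_derivative trace) (at (?N ** G))"
    using det_has_derivative_identity by (simp add: matrix_inv_inverse[OF assms])
  have "((\<lambda>X. det G * det (?N ** X)) has_derivative (\<lambda>H. det G * trace (?N ** H))) (at G)"
    by (intro has_derivative_mult_right has_derivative_compose[OF 1 2])
  moreover have "det G * det (?N ** X) = det X" for X
  proof -
    have "det G * det (?N ** X) = det (G ** ?N ** X)" by (simp add: det_mul)
    then show ?thesis by (simp add: matrix_inv_inverse[OF assms])
  qed
  ultimately show ?thesis by simp
qed

lemma has_derivative_matrix_partial:
  fixes G :: "real^'n::finite \<Rightarrow> real^'m::finite^'k::finite"
  assumes "\<And>a b. (\<lambda>x. G x $ a $ b) differentiable (at x)"
  shows "(G has_derivative (\<lambda>v. \<chi> a b. \<Sum>i\<in>UNIV. v $ i * partial i (\<lambda>x. G x $ a $ b) x)) (at x)"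
proof -
  have "((\<lambda>x. G x \<bullet> c) has_derivative
      (\<lambda>v. (\<chi> a b. \<Sum>i\<in>UNIV. v $ i * partial i (\<lambda>x. G x $ a $ b) x) \<bullet> c)) (at x)"
    if c: "c \<in> Basis" for c
  proof -
    from c obtain a b where c: "c = axis a (axis b 1)" by (auto simp: Basis_vec_def)
    show ?thesis unfolding c inner_axis
      using differentiable_has_derivative_partial[OF assms[of a b]] by simp
  qed
  then show ?thesis by (subst has_derivative_componentwise_within) blast
qed

lemma partial_det:
  fixes G :: "real^'n::finite \<Rightarrow> real^'m::finite^'m"
  assumes d: "\<And>a b. (\<lambda>x. G x $ a $ b) differentiable (at x)" and inv: "invertible (G x)"
  shows "partial i (\<lambda>x. det (G x)) x =
    det (G x) * trace (matrix_inv (G x) ** (\<chi> a b. partial i (\<lambda>x. G x $ a $ b) x))"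
proof -
  have "((\<lambda>x. det (G x)) has_derivative (\<lambda>v. det (G x) * trace (matrix_inv (G x) **
      (\<chi> a b. \<Sum>i\<in>UNIV. v $ i * partial i (\<lambda>x. G x $ a $ b) x)))) (at x)"
    by (rule has_derivative_compose[OF has_derivative_matrix_partial[OF d] det_has_derivative[OF inv]])
  from has_derivative_imp_partial[OF this, of i] show ?thesis
    by (simp add: axis_def if_distrib if_distribR cong: if_cong)
qed

text \<open>The usual formula \<open>1 / sqrt (det G) * (\<Sum>\<^sub>i \<partial>\<^sub>i (sqrt (det G) X\<^sup>i))\<close>, with the product rule carried out so
  that no square root is left.\<close>

definition coord_divergence :: "(real^'n \<Rightarrow> real^'n) \<Rightarrow> (real^'n \<Rightarrow> real^'n^'n) \<Rightarrow> real^'n::finite \<Rightarrow> real" where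
  "coord_divergence X G x = (\<Sum>i\<in>UNIV. partial i (\<lambda>y. X y $ i) x)
     + (\<Sum>i\<in>UNIV. X x $ i * partial i (\<lambda>y. det (G y)) x) / (2 * det (G x))"

text \<open>The term of the Lie derivative that differentiates \<open>G\<close> contributes \<open>X(det G) / det G\<close> by Jacobi's
  formula; each of the other two contributes \<open>\<Sum>\<^sub>i \<partial>\<^sub>i X\<^sup>i\<close>, because the inverse matrix cancels \<open>G\<close>.\<close>

lemma trace_lie_derivative:
  fixes G :: "real^'n::finite \<Rightarrow> real^'n^'n"
  assumes d: "\<And>a b. (\<lambda>x. G x $ a $ b) differentiable (at x)"
    and inv: "invertible (G x)" and sym: "transpose (G x) = G x"
  shows "(\<Sum>j\<in>UNIV. \<Sum>k\<in>UNIV. matrix_inv (G x) $ j $ k * lie_derivative X G x $ j $ k)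
     = 2 * coord_divergence X G x"
proof -
  let ?N = "matrix_inv (G x)" and ?dG = "\<lambda>m j k. partial m (\<lambda>y. G y $ j $ k) x"
    and ?dX = "\<lambda>j m. partial j (\<lambda>y. X y $ m) x"
  have Gs: "G x $ a $ b = G x $ b $ a" for a b
    using arg_cong[OF sym, of "\<lambda>A. A $ b $ a"] by (simp add: transpose_def)
  have Ns: "?N $ a $ b = ?N $ b $ a" for a b
    using arg_cong[OF transpose_matrix_inv_symmetric[OF inv sym], of "\<lambda>A. A $ b $ a"] by (simp add: transpose_def)
  have NG: "(\<Sum>k\<in>UNIV. ?N $ j $ k * G x $ k $ m) = (if j = m then 1 else 0)" for j m
    using arg_cong[OF matrix_inv_inverse(2)[OF inv], of "\<lambda>A. A $ j $ m"]
    by (simp add: matrix_matrix_mult_def mat_def)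
  have det0: "det (G x) \<noteq> 0" using inv invertible_det_nz by blast
  have A: "(\<Sum>j\<in>UNIV. \<Sum>k\<in>UNIV. \<Sum>m\<in>UNIV. ?N $ j $ k * (X x $ m * ?dG m j k))
      = (\<Sum>m\<in>UNIV. X x $ m * partial m (\<lambda>y. det (G y)) x) / det (G x)"
  proof -
    have "partial m (\<lambda>y. det (G y)) x / det (G x) = (\<Sum>j\<in>UNIV. \<Sum>k\<in>UNIV. ?N $ j $ k * ?dG m j k)" for m
    proof -
      have "partial m (\<lambda>y. det (G y)) x / det (G x) = (\<Sum>k\<in>UNIV. \<Sum>j\<in>UNIV. ?N $ k $ j * ?dG m j k)"
        using partial_det[of G x, OF d inv] det0 by (simp add: trace_def matrix_matrix_mult_def)
      also have "\<dots> = (\<Sum>j\<in>UNIV. \<Sum>k\<in>UNIV. ?N $ j $ k * ?dG m j k)"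
        by (subst sum.swap) (simp add: Ns)
      finally show ?thesis .
    qed
    then have "(\<Sum>m\<in>UNIV. X x $ m * partial m (\<lambda>y. det (G y)) x) / det (G x)
      = (\<Sum>m\<in>UNIV. X x $ m * (\<Sum>j\<in>UNIV. \<Sum>k\<in>UNIV. ?N $ j $ k * ?dG m j k))"
      by (simp add: sum_divide_distrib flip: times_divide_eq_right)
    also have "\<dots> = (\<Sum>m\<in>UNIV. \<Sum>j\<in>UNIV. \<Sum>k\<in>UNIV. ?N $ j $ k * (X x $ m * ?dG m j k))"
      by (simp add: sum_distrib_left mult_ac)
    also have "\<dots> = (\<Sum>j\<in>UNIV. \<Sum>k\<in>UNIV. \<Sum>m\<in>UNIV. ?N $ j $ k * (X x $ m * ?dG m j k))"
      by (subst sum.swap, rule sum.cong[OF refl], rule sum.swap)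
    finally show ?thesis by simp
  qed
  have B: "(\<Sum>j\<in>UNIV. \<Sum>k\<in>UNIV. \<Sum>m\<in>UNIV. ?N $ j $ k * (G x $ m $ k * ?dX j m)) = (\<Sum>j\<in>UNIV. ?dX j j)"
  proof (rule sum.cong[OF refl])
    fix j
    have "(\<Sum>k\<in>UNIV. \<Sum>m\<in>UNIV. ?N $ j $ k * (G x $ m $ k * ?dX j m))
      = (\<Sum>m\<in>UNIV. (\<Sum>k\<in>UNIV. ?N $ j $ k * G x $ k $ m) * ?dX j m)"
      by (subst sum.swap) (simp add: sum_distrib_left mult_ac Gs)
    then show "(\<Sum>k\<in>UNIV. \<Sum>m\<in>UNIV. ?N $ j $ k * (G x $ m $ k * ?dX j m)) = ?dX j j"
      unfolding NG by (simp add: mult_delta_left)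
  qed
  have C: "(\<Sum>j\<in>UNIV. \<Sum>k\<in>UNIV. \<Sum>m\<in>UNIV. ?N $ j $ k * (G x $ j $ m * ?dX k m)) = (\<Sum>j\<in>UNIV. ?dX j j)"
  proof -
    have "(\<Sum>j\<in>UNIV. \<Sum>k\<in>UNIV. \<Sum>m\<in>UNIV. ?N $ j $ k * (G x $ j $ m * ?dX k m))
      = (\<Sum>k\<in>UNIV. \<Sum>j\<in>UNIV. \<Sum>m\<in>UNIV. ?N $ k $ j * (G x $ m $ j * ?dX k m))"
      by (subst sum.swap) (simp add: Gs Ns)
    then show ?thesis using B by simp
  qed
  have "(\<Sum>j\<in>UNIV. \<Sum>k\<in>UNIV. ?N $ j $ k * lie_derivative X G x $ j $ k)
    = (\<Sum>j\<in>UNIV. \<Sum>k\<in>UNIV. \<Sum>m\<in>UNIV. ?N $ j $ k * (X x $ m * ?dG m j k))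
     + (\<Sum>j\<in>UNIV. \<Sum>k\<in>UNIV. \<Sum>m\<in>UNIV. ?N $ j $ k * (G x $ m $ k * ?dX j m))
     + (\<Sum>j\<in>UNIV. \<Sum>k\<in>UNIV. \<Sum>m\<in>UNIV. ?N $ j $ k * (G x $ j $ m * ?dX k m))"
    by (simp add: lie_derivative_def sum_distrib_left distrib_left sum.distrib)
  then show ?thesis unfolding A B C coord_divergence_def by simp
qed

text \<open>The trace of the metric with respect to itself is the dimension; this is the contribution of the
  term \<open>lam g\<close> to the traced soliton equation.\<close>

lemma trace_inverse_self:
  fixes A :: "real^'n::finite^'n"
  assumes inv: "invertible A" and sym: "transpose A = A"
  shows "(\<Sum>j\<in>UNIV. \<Sum>k\<in>UNIV. matrix_inv A $ j $ k * A $ j $ k) = real CARD('n)"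
proof -
  have "A $ j $ k = A $ k $ j" for j k
    using arg_cong[OF sym, of "\<lambda>A. A $ k $ j"] by (simp add: transpose_def)
  then have "(\<Sum>j\<in>UNIV. \<Sum>k\<in>UNIV. matrix_inv A $ j $ k * A $ j $ k) = trace (matrix_inv A ** A)"
    by (simp add: trace_def matrix_matrix_mult_def)
  then show ?thesis by (simp add: matrix_inv_inverse[OF inv] trace_def mat_def)
qed

lemma trace_conjugate:
  fixes J :: "real^'n::finite^'n"
  assumes "invertible J"
  shows "trace (matrix_inv J ** (B ** J)) = trace B"
  using matrix_inv_inverse(1)[OF assms] by (metis matrix_mul_assoc matrix_mul_rid trace_mul_sym)

section \<open>Change of variables for nonnegative functions\<close>

text \<open>The change of variables theorem \<open>cov_invertible_nonneg_eq\<close> is stated for index types with a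
  well-order. Any finite index type can be given one, through an injection into \<open>nat\<close>; the order is put on
  a copy of the type, and the coordinates are carried over to the copy.\<close>

typedef 'n ordered_copy = "UNIV :: 'n set" by simp

instance ordered_copy :: (finite) finite
proof
  have "(UNIV :: 'a ordered_copy set) = Abs_ordered_copy ` UNIV"
    by (metis Rep_ordered_copy_inverse surj_def)
  then show "finite (UNIV :: 'a ordered_copy set)" by (metis finite finite_imageI)
qed

instantiation ordered_copy :: (finite) wellorder
begin

definition "(a :: 'a ordered_copy) \<le> b \<longleftrightarrow> to_nat (Rep_ordered_copy a) \<le> to_nat (Rep_ordered_copy b)"
definition "(a :: 'a ordered_copy) < b \<longleftrightarrow> to_nat (Rep_ordered_copy a) < to_nat (Rep_ordered_copy b)"

instance
proof
  fix P :: "'a ordered_copy \<Rightarrow> bool" and a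
  assume step: "\<And>x. (\<And>y. y < x \<Longrightarrow> P y) \<Longrightarrow> P x"
  show "P a"
    by (induction "to_nat (Rep_ordered_copy a)" arbitrary: a rule: less_induct)
      (rule step, simp add: less_ordered_copy_def)
qed (auto simp: less_eq_ordered_copy_def less_ordered_copy_def Rep_ordered_copy_inject)

end

lemma sign_conjugate:
  fixes f :: "'m::finite \<Rightarrow> 'n::finite"
  assumes f: "bij f" and p: "p permutes UNIV"
  shows "sign (f \<circ> p \<circ> inv f) = sign p"
proof -
  have "map_permutation UNIV f p = f \<circ> p \<circ> inv f"
    using bij_is_surj[OF f] by (simp add: map_permutation_def restrict_id_def fun_eq_iff)
  then show ?thesis
    using sign_map_permutation[OF bij_is_inj[OF f] p] by simp
qed

text \<open>Renaming the indices conjugates every permutation in the Leibniz formula, which does not change its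
  sign.\<close>

lemma det_reindex:
  fixes A :: "real^'n::finite^'n" and f :: "'m::finite \<Rightarrow> 'n"
  assumes f: "bij f"
  shows "det (\<chi> i j. A $ f i $ f j) = det A"
proof -
  let ?c = "\<lambda>p. f \<circ> p \<circ> inv f"
  have ff: "inv f (f x) = x" "f (inv f y) = y" for x y
    using f by (simp_all add: bij_is_inj bij_is_surj surj_f_inv_f)
  have bij: "bij_betw ?c {p. p permutes UNIV} {p. p permutes UNIV}"
  proof (rule bij_betw_byWitness[where f' = "\<lambda>q. inv f \<circ> q \<circ> f"])
    show "?c ` {p. p permutes UNIV} \<subseteq> {p. p permutes UNIV}"
      "(\<lambda>q. inv f \<circ> q \<circ> f) ` {p. p permutes UNIV} \<subseteq> {p. p permutes UNIV}"
      using f by (auto intro!: bij_imp_permutes bij_comp bij_imp_bij_inv dest: permutes_bij)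
  qed (auto simp: fun_eq_iff ff)
  have "det A = (\<Sum>p\<in>{p. p permutes UNIV}. of_int (sign (?c p)) * (\<Prod>i\<in>UNIV. A $ i $ ?c p i))"
    unfolding det_def by (rule sum.reindex_bij_betw[OF bij, symmetric])
  also have "\<dots> = (\<Sum>p\<in>{p. p permutes UNIV}. of_int (sign p) * (\<Prod>i\<in>UNIV. A $ f i $ f (p i)))"
  proof (rule sum.cong[OF refl])
    fix p :: "'m \<Rightarrow> 'm" assume p: "p \<in> {p. p permutes UNIV}"
    have "(\<Prod>i\<in>UNIV. A $ i $ ?c p i) = (\<Prod>i\<in>UNIV. A $ f i $ ?c p (f i))"
      by (rule prod.reindex_bij_betw[OF f, symmetric])
    then show "of_int (sign (?c p)) * (\<Prod>i\<in>UNIV. A $ i $ ?c p i)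
        = of_int (sign p) * (\<Prod>i\<in>UNIV. A $ f i $ f (p i))"
      using sign_conjugate[OF f, of p] p by (simp add: ff)
  qed
  finally show ?thesis by (simp add: det_def)
qed

definition reorder :: "real^'n \<Rightarrow> real^'n::finite ordered_copy" where
  "reorder x = (\<chi> i. x $ Rep_ordered_copy i)"

definition unorder :: "real^'n::finite ordered_copy \<Rightarrow> real^'n" where
  "unorder y = (\<chi> i. y $ Abs_ordered_copy i)"

lemma bij_Rep_ordered_copy: "bij Rep_ordered_copy"
  by (metis Abs_ordered_copy_inverse Rep_ordered_copy_inverse UNIV_I bij_def inj_on_inverseI surjI)

lemma reorder_unorder [simp]: "reorder (unorder y) = y" "unorder (reorder x) = x"
  by (simp_all add: reorder_def unorder_def vec_eq_iff Abs_ordered_copy_inverse Rep_ordered_copy_inverse)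

lemma bounded_linear_reorder: "bounded_linear reorder" "bounded_linear unorder"
  unfolding linear_conv_bounded_linear[symmetric]
  by (auto intro!: linearI simp: reorder_def unorder_def vec_eq_iff)

lemma reorder_borel [measurable]: "reorder \<in> borel_measurable borel" "unorder \<in> borel_measurable borel"
  by (simp_all add: bounded_linear_reorder borel_measurable_continuous_onI linear_continuous_on)

text \<open>Renaming the coordinates maps boxes to boxes with the same side lengths.\<close>

lemma lborel_unorder: "distr lborel borel (unorder :: _ \<Rightarrow> real^'n::finite) = lborel"
proof (rule lborel_eqI[symmetric])
  fix l u :: "real^'n" assume le: "\<And>b. b \<in> Basis \<Longrightarrow> l \<bullet> b \<le> u \<bullet> b"
  have le': "l $ i \<le> u $ i" for i using le[of "axis i 1"] by (simp add: inner_axis)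
  have inj_axis: "inj (\<lambda>i::'m::finite. axis i (1::real))" by (auto simp: inj_def axis_eq_axis)
  have B: "(Basis :: (real^'m::finite) set) = range (\<lambda>i. axis i 1)" by (auto simp: Basis_vec_def)
  have box: "unorder -` box l u = box (reorder l) (reorder u)"
    by (auto simp: mem_box_cart unorder_def reorder_def)
      (metis Abs_ordered_copy_inverse UNIV_I Rep_ordered_copy_inverse)+
  have "emeasure (distr lborel borel unorder) (box l u) = emeasure lborel (box (reorder l) (reorder u))"
    by (simp add: emeasure_distr box)
  also have "\<dots> = (\<Prod>b\<in>Basis. (reorder u - reorder l) \<bullet> b)"
  proof (rule emeasure_lborel_box)
    fix b :: "real^'n ordered_copy" assume "b \<in> Basis"
    then show "reorder l \<bullet> b \<le> reorder u \<bullet> b"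
      using le' by (auto simp: B inner_axis reorder_def)
  qed
  also have "(\<Prod>b\<in>Basis. (reorder u - reorder l) \<bullet> b) = (\<Prod>i\<in>UNIV. u $ Rep_ordered_copy i - l $ Rep_ordered_copy i)"
    unfolding B by (subst prod.reindex[OF inj_axis]) (simp add: inner_axis reorder_def)
  also have "\<dots> = (\<Prod>i\<in>UNIV. u $ i - l $ i)"
    by (rule prod.reindex_bij_betw[OF bij_Rep_ordered_copy])
  also have "\<dots> = (\<Prod>b\<in>Basis. (u - l) \<bullet> b)"
    unfolding B by (subst prod.reindex[OF inj_axis]) (simp add: inner_axis)
  finally show "emeasure (distr lborel borel unorder) (box l u) = (\<Prod>b\<in>Basis. (u - l) \<bullet> b)" .
qed simp

lemma nn_integral_unorder:
  fixes h :: "real^'n::finite \<Rightarrow> ennreal"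
  assumes [measurable]: "h \<in> borel_measurable borel"
  shows "(\<integral>\<^sup>+x. h x \<partial>lborel) = (\<integral>\<^sup>+y. h (unorder y) \<partial>lborel)"
  by (subst lborel_unorder[symmetric]) (simp add: nn_integral_distr)

lemma has_integral_iff_nn_integral_lborel:
  fixes F :: "'b::euclidean_space \<Rightarrow> real"
  assumes "F \<in> borel_measurable borel" "\<And>x. 0 \<le> F x"
  shows "(F has_integral r) UNIV \<longleftrightarrow> (\<integral>\<^sup>+x. F x \<partial>lborel) = ennreal r \<and> 0 \<le> r"
proof -
  have "F \<in> borel_measurable lebesgue"
    using assms(1) by (intro measurable_completion) simp
  then show ?thesis
    using has_integral_iff_nn_integral_lebesgue[of F r, OF assms(2)]
    by (simp add: nn_integral_completion)
qed

text \<open>For every real \<open>r\<close> the one integral has the value \<open>r\<close> if and only if the other has. Two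
  elements of \<open>ennreal\<close> with this property are equal, so that an infinite integral on one side
  forces an infinite integral on the other.\<close>

lemma nn_integral_change_of_variables_wellorder:
  fixes w :: "real^'n::{finite,wellorder} \<Rightarrow> real" and t :: "real^'n::_ \<Rightarrow> real^'n::_"
  assumes dt: "\<And>x. x \<in> S \<Longrightarrow> (t has_derivative t' x) (at x within S)"
    and dh: "\<And>y. y \<in> T \<Longrightarrow> (h has_derivative h' y) (at y within T)"
    and w: "\<And>y. y \<in> T \<Longrightarrow> 0 \<le> w y"
    and ht: "\<And>x. x \<in> S \<Longrightarrow> t x \<in> T \<and> h (t x) = x"
    and th: "\<And>y. y \<in> T \<Longrightarrow> h y \<in> S \<and> t (h y) = y"
    and inv: "\<And>y. y \<in> T \<Longrightarrow> h' y \<circ> t' (h y) = id"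
    and mT: "(\<lambda>y. indicator T y * w y) \<in> borel_measurable borel"
    and mS: "(\<lambda>x. indicator S x * (\<bar>det (matrix (t' x))\<bar> * w (t x))) \<in> borel_measurable borel"
  shows "(\<integral>\<^sup>+y. ennreal (indicator T y * w y) \<partial>lborel)
    = (\<integral>\<^sup>+x. ennreal (indicator S x * (\<bar>det (matrix (t' x))\<bar> * w (t x))) \<partial>lborel)"
proof -
  let ?F = "\<lambda>y. indicator T y * w y"
  let ?H = "\<lambda>x. indicator S x * (\<bar>det (matrix (t' x))\<bar> * w (t x))"
  have F0: "0 \<le> ?F y" for y using w by (simp add: indicator_def)
  have H0: "0 \<le> ?H x" for x using w ht by (simp add: indicator_def)
  have "(\<integral>\<^sup>+y. ?F y \<partial>lborel) = ennreal r \<longleftrightarrow> (\<integral>\<^sup>+x. ?H x \<partial>lborel) = ennreal r" if r: "0 \<le> r" for r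
  proof -
    have "(?F has_integral r) UNIV \<longleftrightarrow> (w has_integral r) T"
      by (subst has_integral_restrict_UNIV[symmetric], rule has_integral_cong) (auto simp: indicator_def)
    also have "\<dots> \<longleftrightarrow> ((\<lambda>x. \<bar>det (matrix (t' x))\<bar> * w (t x)) has_integral r) S"
      by (rule cov_invertible_nonneg_eq[OF dt dh w ht th inv, symmetric])
    also have "\<dots> \<longleftrightarrow> (?H has_integral r) UNIV"
      by (subst has_integral_restrict_UNIV[symmetric], rule has_integral_cong) (auto simp: indicator_def)
    finally show ?thesis
      using has_integral_iff_nn_integral_lborel[OF mT F0, where r = r]
        has_integral_iff_nn_integral_lborel[OF mS H0, where r = r] r by simp
  qed
  moreover have "a = b" if *: "\<And>r::real. 0 \<le> r \<Longrightarrow> a = ennreal r \<longleftrightarrow> b = ennreal r" for a b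
  proof (cases a)
    case (real r)
    then show ?thesis using *[of r] by simp
  next
    case top
    then show ?thesis using * by (cases b) auto
  qed
  ultimately show ?thesis by blast
qed

theorem nn_integral_change_of_variables:
  fixes w :: "real^'n::finite \<Rightarrow> real" and t :: "real^'n \<Rightarrow> real^'n"
  assumes dt: "\<And>x. x \<in> S \<Longrightarrow> (t has_derivative t' x) (at x within S)"
    and dh: "\<And>y. y \<in> T \<Longrightarrow> (h has_derivative h' y) (at y within T)"
    and w: "\<And>y. y \<in> T \<Longrightarrow> 0 \<le> w y"
    and ht: "\<And>x. x \<in> S \<Longrightarrow> t x \<in> T \<and> h (t x) = x"
    and th: "\<And>y. y \<in> T \<Longrightarrow> h y \<in> S \<and> t (h y) = y"
    and inv: "\<And>y. y \<in> T \<Longrightarrow> h' y \<circ> t' (h y) = id"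
    and mT [measurable]: "(\<lambda>y. indicator T y * w y) \<in> borel_measurable borel"
    and mS [measurable]: "(\<lambda>x. indicator S x * (\<bar>det (matrix (t' x))\<bar> * w (t x))) \<in> borel_measurable borel"
  shows "(\<integral>\<^sup>+y. ennreal (indicator T y * w y) \<partial>lborel)
    = (\<integral>\<^sup>+x. ennreal (indicator S x * (\<bar>det (matrix (t' x))\<bar> * w (t x))) \<partial>lborel)"
proof -
  let ?S = "reorder ` S" and ?T = "reorder ` T"
  let ?t = "\<lambda>x. reorder (t (unorder x))" and ?t' = "\<lambda>x v. reorder (t' (unorder x) (unorder v))"
  let ?h = "\<lambda>x. reorder (h (unorder x))" and ?h' = "\<lambda>x v. reorder (h' (unorder x) (unorder v))"
  let ?w = "\<lambda>y. w (unorder y)"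
  have indT: "indicator ?T y = (indicator T (unorder y) :: real)"
    and indS: "indicator ?S y = (indicator S (unorder y) :: real)" for y
    by (auto simp: indicator_def image_iff) (metis reorder_unorder(1))+
  have der: "((\<lambda>x. reorder (k (unorder x))) has_derivative (\<lambda>v. reorder (k' (unorder v)))) (at (reorder x) within reorder ` U)"
    if "(k has_derivative k') (at x within U)" for k :: "real^'n \<Rightarrow> real^'n" and k' x U
  proof -
    have 1: "(unorder has_derivative unorder) (at (reorder x) within reorder ` U)"
      by (rule bounded_linear_imp_has_derivative[OF bounded_linear_reorder(2)])
    have "unorder ` reorder ` U = U" by (simp add: image_image)
    then have "((\<lambda>x. k (unorder x)) has_derivative (\<lambda>v. k' (unorder v))) (at (reorder x) within reorder ` U)"
      using has_derivative_in_compose[OF 1, of k k'] that by simp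
    then show ?thesis
      using bounded_linear.has_derivative[OF bounded_linear_reorder(1)] by blast
  qed
  have det: "det (matrix (?t' (reorder x))) = det (matrix (t' x))" for x
  proof -
    have r: "reorder v $ i = v $ Rep_ordered_copy i" for v :: "real^'n" and i
      by (simp add: reorder_def)
    have ax: "unorder (axis j 1) = axis (Rep_ordered_copy j) 1" for j
      by (auto simp: unorder_def vec_eq_iff axis_def) (metis Abs_ordered_copy_inverse UNIV_I Rep_ordered_copy_inverse)+
    have "matrix (?t' (reorder x)) = (\<chi> i j. matrix (t' x) $ Rep_ordered_copy i $ Rep_ordered_copy j)"
      by (simp add: matrix_def vec_eq_iff r ax)
    then show ?thesis using det_reindex[OF bij_Rep_ordered_copy] by metis
  qed
  have det': "det (matrix (?t' y)) = det (matrix (t' (unorder y)))" for y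
    using det[of "unorder y"] by simp
  have "(\<integral>\<^sup>+y. ennreal (indicator T y * w y) \<partial>lborel)
    = (\<integral>\<^sup>+y. ennreal (indicator ?T y * ?w y) \<partial>lborel)"
    unfolding indT by (rule nn_integral_unorder) measurable
  also have "\<dots> = (\<integral>\<^sup>+x. ennreal (indicator ?S x * (\<bar>det (matrix (?t' x))\<bar> * ?w (?t x))) \<partial>lborel)"
  proof (rule nn_integral_change_of_variables_wellorder[where h = ?h and h' = ?h'])
    show "(?t has_derivative ?t' x) (at x within ?S)" if "x \<in> ?S" for x
      using that der[OF dt] by auto
    show "(?h has_derivative ?h' x) (at x within ?T)" if "x \<in> ?T" for x
      using that der[OF dh] by auto
    show "?h' y \<circ> ?t' (?h y) = id" if "y \<in> ?T" for y
      using that inv by (auto simp: fun_eq_iff)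
    show "(\<lambda>y. indicator ?T y * ?w y) \<in> borel_measurable borel"
      unfolding indT using measurable_compose[OF reorder_borel(2) mT] .
    show "(\<lambda>x. indicator ?S x * (\<bar>det (matrix (?t' x))\<bar> * ?w (?t x))) \<in> borel_measurable borel"
      unfolding indS det' using measurable_compose[OF reorder_borel(2) mS] by simp
  qed (use w ht th in auto)
  also have "\<dots> = (\<integral>\<^sup>+x. ennreal (indicator S x * (\<bar>det (matrix (t' x))\<bar> * w (t x))) \<partial>lborel)"
    unfolding indS det' using nn_integral_unorder[OF measurable_compose[OF mS measurable_ennreal]] by simp
  finally show ?thesis .
qed

section \<open>Partial derivatives integrate to zero\<close>

lemma integrable_compact_support:
  fixes F :: "'b::euclidean_space \<Rightarrow> real"
  assumes "continuous_on UNIV F" "compact K" "\<And>x. x \<notin> K \<Longrightarrow> F x = 0"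
  shows "integrable lborel F"
proof -
  have "integrable lborel (\<lambda>x. indicator K x *\<^sub>R F x)"
    using assms by (intro borel_integrable_compact) (auto intro: continuous_on_subset)
  moreover have "(\<lambda>x. indicator K x *\<^sub>R F x) = F"
    using assms(3) by (auto simp: indicator_def fun_eq_iff)
  ultimately show ?thesis by simp
qed

lemma integral_lborel_translate:
  fixes F :: "'b::euclidean_space \<Rightarrow> real"
  assumes "F \<in> borel_measurable borel"
  shows "(\<integral>x. F (x + c) \<partial>lborel) = (\<integral>x. F x \<partial>lborel)"
proof -
  have "(\<integral>x. F x \<partial>lborel) = (\<integral>x. F x \<partial>distr lborel borel ((+) c))"
    by (simp only: lborel_distr_plus)
  also have "\<dots> = (\<integral>x. F (c + x) \<partial>lborel)"
    using assms by (intro integral_distr) auto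
  finally show ?thesis by (simp add: add.commute)
qed

text \<open>The difference quotients of \<open>F\<close> in direction \<open>i\<close> have integral zero, because Lebesgue measure is
  invariant under translations. They converge to the partial derivative and are dominated by a
  multiple of the indicator of a ball.\<close>

proposition integral_partial_compact_support:
  fixes F :: "real^'n::finite \<Rightarrow> real"
  assumes F: "Ck_on 1 UNIV F" and K: "compact K" "\<And>x. x \<notin> K \<Longrightarrow> F x = 0"
  shows "integrable lborel (partial i F)" "(\<integral>x. partial i F x \<partial>lborel) = 0"
proof -
  define e :: "real^'n" where "e = axis i 1"
  have dF: "F differentiable (at x)" for x using F by simp
  have cF: "continuous_on UNIV F" using Ck_on_Suc_D[of 0 UNIV F] F by simp
  have cp: "continuous_on UNIV (partial i F)" using F by simp
  \<comment> \<open>The partial derivative vanishes outside the closed set \<open>K\<close> because \<open>F\<close> is locally constant there.\<close>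
  have p0: "partial i F x = 0" if "x \<notin> K" for x
  proof -
    have "partial i F x = partial i (\<lambda>x. 0) x"
      by (rule partial_cong[of "- K"]) (use K that compact_imp_closed in auto)
    then show ?thesis by simp
  qed
  show int: "integrable lborel (partial i F)"
    by (rule integrable_compact_support[OF cp K(1) p0])
  have iF: "integrable lborel F"
    by (rule integrable_compact_support[OF cF K])
  have mF[measurable]: "F \<in> borel_measurable borel" "partial i F \<in> borel_measurable borel"
    using cF cp borel_measurable_continuous_onI by blast+
  obtain R where R: "K \<subseteq> cball 0 R"
    using compact_imp_bounded[OF K(1)] by (force simp: bounded_iff)
  obtain C where C: "\<And>x. \<bar>partial i F x\<bar> \<le> C"
  proof -
    have "bounded (partial i F ` K)"
      using K(1) cp by (intro compact_imp_bounded compact_continuous_image) (auto intro: continuous_on_subset)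
    then obtain C where "\<forall>y\<in>K. \<bar>partial i F y\<bar> \<le> C" by (auto simp: bounded_iff)
    then have "\<bar>partial i F x\<bar> \<le> max C 0" for x using p0[of x] by (cases "x \<in> K") auto
    then show ?thesis using that by blast
  qed
  define a where "a n = inverse (real (Suc n))" for n
  have a: "0 < a n" "a n \<le> 1" for n by (auto simp: a_def field_simps)
  define q where "q n x = (F (x + a n *\<^sub>R e) - F x) / a n" for n x
  \<comment> \<open>The radius is enlarged by 1, the largest possible step, since the quotient also sees \<open>F\<close> at the
    translated point.\<close>
  have bound: "norm (q n x) \<le> C * indicator (cball 0 (R + 1)) x" for n x
  proof -
    have "((\<lambda>s. F (x + s *\<^sub>R e)) has_real_derivative partial i F (x + s *\<^sub>R e)) (at s)" for s
      unfolding e_def by (rule partial_along_axis[OF dF])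
    from MVT2[OF a(1)[of n] this] obtain s where s: "0 < s" "s < a n"
      "F (x + a n *\<^sub>R e) - F x = a n * partial i F (x + s *\<^sub>R e)" by auto
    then have q: "q n x = partial i F (x + s *\<^sub>R e)" using a[of n] by (simp add: q_def)
    show ?thesis
    proof (cases "x \<in> cball 0 (R + 1)")
      case True
      then show ?thesis using q C by simp
    next
      case False
      have "norm x \<le> norm (x + s *\<^sub>R e) + s"
        using norm_triangle_ineq4[of "x + s *\<^sub>R e" "s *\<^sub>R e"] s by (simp add: e_def)
      then have "x + s *\<^sub>R e \<notin> K" using False R s a(2)[of n] by (auto simp: subset_iff)
      then show ?thesis using q p0 False by simp
    qed
  qed
  have lim: "(\<lambda>n. q n x) \<longlonglongrightarrow> partial i F x" for x
  proof -
    have "((\<lambda>s. F (x + s *\<^sub>R e)) has_real_derivative partial i F (x + 0 *\<^sub>R e)) (at 0)"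
      unfolding e_def by (rule partial_along_axis[OF dF])
    then have "((\<lambda>h. (F (x + h *\<^sub>R e) - F x) / h) \<longlongrightarrow> partial i F x) (at 0)"
      by (simp add: DERIV_def)
    moreover have "filterlim a (at 0) sequentially"
      using LIMSEQ_inverse_real_of_nat a(1) unfolding filterlim_at a_def[abs_def] by auto
    ultimately show ?thesis unfolding q_def by (rule filterlim_compose)
  qed
  have "(\<lambda>n. \<integral>x. q n x \<partial>lborel) \<longlonglongrightarrow> (\<integral>x. partial i F x \<partial>lborel)"
  proof (rule integral_dominated_convergence[where w = "\<lambda>x. C * indicator (cball 0 (R + 1)) x"])
    have "integrable lborel (indicator (cball (0::real^'n) (R + 1)) :: _ \<Rightarrow> real)"
      by (simp add: integrable_indicator_iff emeasure_bounded_finite[OF bounded_cball, simplified])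
    then show "integrable lborel (\<lambda>x::real^'n. C * indicator (cball 0 (R + 1)) x)" by simp
    show "AE x in lborel. (\<lambda>n. q n x) \<longlonglongrightarrow> partial i F x" using lim by simp
    show "AE x in lborel. norm (q n x) \<le> C * indicator (cball 0 (R + 1)) x" for n using bound by simp
    show "q n \<in> borel_measurable lborel" for n unfolding q_def[abs_def] by measurable
  qed simp
  moreover have "(\<integral>x. q n x \<partial>lborel) = 0" for n
  proof -
    have "integrable lborel (\<lambda>x. F (x + a n *\<^sub>R e))"
    proof (rule integrable_compact_support)
      show "continuous_on UNIV (\<lambda>x. F (x + a n *\<^sub>R e))"
        by (intro continuous_on_compose2[OF cF] continuous_intros) auto
      show "compact ((\<lambda>x. x - a n *\<^sub>R e) ` K)"
        by (intro compact_continuous_image continuous_intros K)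
      show "F (x + a n *\<^sub>R e) = 0" if "x \<notin> (\<lambda>x. x - a n *\<^sub>R e) ` K" for x
      proof (rule K(2))
        show "x + a n *\<^sub>R e \<notin> K"
          using that image_eqI[of x "\<lambda>x. x - a n *\<^sub>R e" "x + a n *\<^sub>R e" K] by auto
      qed
    qed
    then show ?thesis
      unfolding q_def using iF integral_lborel_translate[OF mF(1)] by simp
  qed
  ultimately show "(\<integral>x. partial i F x \<partial>lborel) = 0"
    by (simp add: LIMSEQ_const_iff)
qed

section \<open>Charts and transition maps\<close>

locale closed_riemannian_manifold =
  fixes M :: "'a::{t2_space,second_countable_topology} set"
    and A :: "('a, 'n::finite) chart set"
    and g :: "('a, 'n) tensor2"
  assumes closed_manifold: "closed_manifold M A"
    and metric: "riemannian_metric A g"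
begin

abbreviation density_in :: "('a, 'n) chart \<Rightarrow> real^'n \<Rightarrow> real" where
  "density_in c x \<equiv> sqrt (det (g c x))"

lemma manifold: "smooth_manifold M A" and compact_M: "compact M"
  using closed_manifold by (auto simp: closed_manifold_def)

lemma M_borel [measurable]: "M \<in> sets borel"
  using compact_M by (simp add: borel_closed compact_imp_closed)

lemma M_eq: "M = (\<Union>c\<in>A. chart_dom c)"
  using manifold by (auto simp: smooth_manifold_def)

context
  fixes c assumes c: "c \<in> A"
begin

lemma chart_dom_subset: "chart_dom c \<subseteq> M"
  using c M_eq by auto

lemma chart_dom_openin: "openin (top_of_set M) (chart_dom c)"
  and open_chart_img: "open (chart_img c)"
  and chart_homeomorphism: "homeomorphism (chart_dom c) (chart_img c) (chart_map c) (chart_inv c)"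
  using manifold c by (auto simp: smooth_manifold_def)

lemma chart_inv_map [simp]: "p \<in> chart_dom c \<Longrightarrow> chart_inv c (chart_map c p) = p"
  and chart_map_inv [simp]: "x \<in> chart_img c \<Longrightarrow> chart_map c (chart_inv c x) = x"
  and chart_inv_in [simp]: "x \<in> chart_img c \<Longrightarrow> chart_inv c x \<in> chart_dom c"
  and chart_map_in [simp]: "p \<in> chart_dom c \<Longrightarrow> chart_map c p \<in> chart_img c"
  and continuous_on_chart_map: "continuous_on (chart_dom c) (chart_map c)"
  and continuous_on_chart_inv: "continuous_on (chart_img c) (chart_inv c)"
  using chart_homeomorphism by (auto simp: homeomorphism_def)

lemma chart_inv_in_M: "x \<in> chart_img c \<Longrightarrow> chart_inv c x \<in> M"
  using chart_inv_in chart_dom_subset by blast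

lemma chart_dom_borel [measurable]: "chart_dom c \<in> sets borel"
proof -
  obtain T where "open T" "chart_dom c = M \<inter> T"
    using chart_dom_openin by (auto simp: openin_open)
  then show ?thesis by simp
qed

lemma chart_img_borel [measurable]: "chart_img c \<in> sets borel"
  using open_chart_img by simp

text \<open>Images under a chart map are preimages under the chart inverse, which is continuous on an open
  set; openness and measurability of images are read off from this.\<close>

lemma chart_image_eq:
  "B \<subseteq> chart_dom c \<Longrightarrow> chart_map c ` B = chart_inv c -` B \<inter> chart_img c"
  by (force simp: subset_iff image_iff)

lemma chart_inv_measurable [measurable]:
  "chart_inv c \<in> measurable (restrict_space borel (chart_img c)) (restrict_space borel M)"
  using borel_measurable_continuous_on_restrict[OF continuous_on_chart_inv] chart_inv_in_M
  by (intro measurable_restrict_space2) (auto simp: space_restrict_space)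

lemma chart_image_borel:
  assumes "B \<in> sets borel" "B \<subseteq> chart_dom c"
  shows "chart_map c ` B \<in> sets borel"
proof -
  have "chart_inv c -` B \<inter> chart_img c \<in> sets (restrict_space borel (chart_img c))"
    using measurable_sets[OF borel_measurable_continuous_on_restrict[OF continuous_on_chart_inv] assms(1)]
    by (simp add: space_restrict_space)
  then show ?thesis
    using sets_restrict_space_iff[of "chart_img c" borel] chart_img_borel
    by (simp add: chart_image_eq[OF assms(2)])
qed

lemma open_chart_image_Int:
  assumes "openin (top_of_set M) W"
  shows "open (chart_map c ` (chart_dom c \<inter> W))"
proof -
  obtain T where T: "open T" "W = M \<inter> T" using assms by (auto simp: openin_open)
  have "chart_map c ` (chart_dom c \<inter> W) = chart_img c \<inter> chart_inv c -` T"
    using chart_inv_in_M T(2) by (subst chart_image_eq) auto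
  then show ?thesis
    using continuous_open_preimage[OF continuous_on_chart_inv open_chart_img T(1)] by simp
qed

lemma metric_smooth: "Ck_on k (chart_img c) (\<lambda>x. g c x $ i $ j)"
  and metric_sym: "x \<in> chart_img c \<Longrightarrow> transpose (g c x) = g c x"
  and metric_pos: "x \<in> chart_img c \<Longrightarrow> v \<noteq> 0 \<Longrightarrow> v \<bullet> (g c x *v v) > 0"
  using metric c by (auto simp: riemannian_metric_def smooth_on_def)

lemma metric_det_pos: "x \<in> chart_img c \<Longrightarrow> det (g c x) > 0"
  and metric_invertible: "x \<in> chart_img c \<Longrightarrow> invertible (g c x)"
  using posdef_det_pos posdef_invertible metric_pos by blast+

lemma metric_det_smooth: "Ck_on k (chart_img c) (\<lambda>x. det (g c x))"
  by (intro Ck_on_det open_chart_img metric_smooth)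

lemma density_continuous: "continuous_on (chart_img c) (density_in c)"
  using metric_det_smooth[of 0] by (auto intro: continuous_on_real_sqrt)

lemma density_measurable:
  "density_in c \<in> borel_measurable (restrict_space borel (chart_img c))"
  by (rule borel_measurable_continuous_on_restrict[OF density_continuous])

end

lemma transition_smooth:
  assumes "c \<in> A" "d \<in> A"
  shows "Ck_on k (chart_map c ` (chart_dom c \<inter> chart_dom d)) (\<lambda>x. transition c d x $ i)"
  using manifold assms by (auto simp: smooth_manifold_def smooth_on_def)

lemma open_overlap: "c \<in> A \<Longrightarrow> d \<in> A \<Longrightarrow> open (chart_map c ` (chart_dom c \<inter> chart_dom d))"
  by (rule open_chart_image_Int) (auto intro: chart_dom_openin)

lemma transition_in_overlap:
  assumes "c \<in> A" "d \<in> A" "x \<in> chart_map c ` (chart_dom c \<inter> chart_dom d)"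
  shows "transition c d x \<in> chart_map d ` (chart_dom d \<inter> chart_dom c)"
    and "transition d c (transition c d x) = x"
    and "chart_inv d (transition c d x) = chart_inv c x"
    and "x \<in> chart_img c" "transition c d x \<in> chart_img d"
  using assms by (auto simp: transition_def)

lemma transition_has_derivative:
  assumes "c \<in> A" "d \<in> A" "x \<in> chart_map c ` (chart_dom c \<inter> chart_dom d)"
  shows "(transition c d has_derivative (*v) (transition_matrix c d x)) (at x)"
    and "transition_matrix c d x $ i $ j = partial j (\<lambda>x. transition c d x $ i) x"
proof -
  have d: "(\<lambda>x. transition c d x $ i) differentiable (at x)" for i
    using transition_smooth[OF assms(1,2), of 1 i, unfolded One_nat_def Ck_on.simps] assms(3) by blast
  have "transition c d differentiable (at x)"
    using has_derivative_vec_partial[of "transition c d", OF d] differentiable_def by blast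
  then show *: "(transition c d has_derivative (*v) (transition_matrix c d x)) (at x)"
    unfolding jacobian_works transition_matrix_def jacobian_def .
  have "((\<lambda>x. transition c d x $ i) has_derivative (\<lambda>v. (transition_matrix c d x *v v) $ i)) (at x)"
    by (rule bounded_linear.has_derivative[OF bounded_linear_vec_nth *])
  from has_derivative_imp_partial[OF this, of j]
  show "transition_matrix c d x $ i $ j = partial j (\<lambda>x. transition c d x $ i) x"
    by (simp add: matrix_vector_mult_basis column_def)
qed

text \<open>Differentiate \<open>transition d c \<circ> transition c d = id\<close>.\<close>

lemma transition_matrix_inverse:
  assumes "c \<in> A" "d \<in> A" "x \<in> chart_map c ` (chart_dom c \<inter> chart_dom d)"
  shows "transition_matrix d c (transition c d x) ** transition_matrix c d x = mat 1"
proof -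
  note t = transition_in_overlap[OF assms]
  have "((\<lambda>y. transition d c (transition c d y)) has_derivative
      (\<lambda>v. transition_matrix d c (transition c d x) *v (transition_matrix c d x *v v))) (at x)"
    by (rule has_derivative_compose[OF transition_has_derivative(1)[OF assms]
        transition_has_derivative(1)[OF assms(2,1) t(1)]])
  moreover have "((\<lambda>y. transition d c (transition c d y)) has_derivative (\<lambda>v. v)) (at x)"
    by (rule has_derivative_cong_open[THEN iffD2, OF open_overlap[OF assms(1,2)] assms(3) _ has_derivative_ident])
      (rule transition_in_overlap(2)[OF assms(1,2)])
  ultimately have "(\<lambda>v. transition_matrix d c (transition c d x) *v (transition_matrix c d x *v v)) = (\<lambda>v. v)"
    by (rule has_derivative_unique)
  then show ?thesis
    by (metis matrix_eq matrix_vector_mul_assoc matrix_vector_mul_lid)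
qed

lemma metric_transition:
  assumes "c \<in> A" "d \<in> A" "x \<in> chart_map c ` (chart_dom c \<inter> chart_dom d)"
  shows "g c x = transpose (transition_matrix c d x) ** g d (transition c d x) ** transition_matrix c d x"
  using metric assms unfolding riemannian_metric_def by blast

text \<open>Take determinants in the transformation law of the metric.\<close>

lemma density_transition:
  assumes "c \<in> A" "d \<in> A" "x \<in> chart_map c ` (chart_dom c \<inter> chart_dom d)"
  shows "density_in c x = \<bar>det (transition_matrix c d x)\<bar> * density_in d (transition c d x)"
    and "det (g c x) = (det (transition_matrix c d x))\<^sup>2 * det (g d (transition c d x))"
proof -
  show "det (g c x) = (det (transition_matrix c d x))\<^sup>2 * det (g d (transition c d x))"
    by (simp add: metric_transition[OF assms] det_mul power2_eq_square)
  then show "density_in c x = \<bar>det (transition_matrix c d x)\<bar> * density_in d (transition c d x)"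
    by (simp add: real_sqrt_mult)
qed

section \<open>The Riemannian volume\<close>

definition chart_volume :: "('a, 'n) chart \<Rightarrow> 'a set \<Rightarrow> ennreal" where
  "chart_volume c B = (\<integral>\<^sup>+x\<in>chart_map c ` B. ennreal (density_in c x) \<partial>lborel)"

text \<open>The Jacobian factor of the change of variables is exactly the factor by which the
  densities \<open>sqrt (det g)\<close> of the two charts differ.\<close>

lemma chart_volume_eq:
  assumes c: "c \<in> A" and d: "d \<in> A" and B: "B \<in> sets borel" "B \<subseteq> chart_dom c" "B \<subseteq> chart_dom d"
  shows "chart_volume c B = chart_volume d B"
proof -
  let ?S = "chart_map c ` B" and ?T = "chart_map d ` B"
  let ?t' = "\<lambda>x. (*v) (transition_matrix c d x)" and ?h' = "\<lambda>x. (*v) (transition_matrix d c x)"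
  have S: "x \<in> chart_map c ` (chart_dom c \<inter> chart_dom d)" if "x \<in> ?S" for x using that B by auto
  have T: "x \<in> chart_map d ` (chart_dom d \<inter> chart_dom c)" if "x \<in> ?T" for x using that B by auto
  have meas: "(\<lambda>y. indicator (chart_map e ` B) y * density_in e y) \<in> borel_measurable borel"
    if "e \<in> A" "B \<subseteq> chart_dom e" for e
  proof -
    have "chart_map e ` B \<subseteq> chart_img e" using that by auto
    then have "density_in e \<in> borel_measurable (restrict_space borel (chart_map e ` B))"
      by (intro borel_measurable_continuous_on_restrict continuous_on_subset[OF density_continuous[OF that(1)]])
    then show ?thesis
      using chart_image_borel[OF that(1) B(1) that(2)]
      by (simp add: borel_measurable_restrict_space_iff mult.commute)
  qed
  have dens: "indicator ?S x * (\<bar>det (matrix (?t' x))\<bar> * density_in d (transition c d x))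
    = indicator ?S x * density_in c x" for x
    using density_transition(1)[OF c d S, of x] by (cases "x \<in> ?S") auto
  have "(\<integral>\<^sup>+y. ennreal (indicator ?T y * density_in d y) \<partial>lborel)
    = (\<integral>\<^sup>+x. ennreal (indicator ?S x * (\<bar>det (matrix (?t' x))\<bar> * density_in d (transition c d x))) \<partial>lborel)"
  proof (rule nn_integral_change_of_variables[where h = "transition d c" and h' = ?h'])
    show "(transition c d has_derivative ?t' x) (at x within ?S)" if "x \<in> ?S" for x
      by (rule has_derivative_at_withinI[OF transition_has_derivative(1)[OF c d S[OF that]]])
    show "(transition d c has_derivative ?h' x) (at x within ?T)" if "x \<in> ?T" for x
      by (rule has_derivative_at_withinI[OF transition_has_derivative(1)[OF d c T[OF that]]])
    show "0 \<le> density_in d y" if "y \<in> ?T" for y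
      using metric_det_pos[OF d, of y] T[OF that] transition_in_overlap(4)[OF d c] by (simp add: less_imp_le)
    show "transition c d x \<in> ?T \<and> transition d c (transition c d x) = x" if "x \<in> ?S" for x
      using that B c d by (auto simp: transition_def subset_iff)
    show "transition d c x \<in> ?S \<and> transition c d (transition d c x) = x" if "x \<in> ?T" for x
      using that B c d by (auto simp: transition_def subset_iff)
    show "?h' y \<circ> ?t' (transition d c y) = id" if "y \<in> ?T" for y
    proof -
      have "transition_matrix d c y ** transition_matrix c d (transition d c y) = mat 1"
        using transition_matrix_inverse[OF d c T[OF that]] matrix_left_right_inverse by blast
      then show ?thesis by (simp add: fun_eq_iff matrix_vector_mul_assoc)
    qed
    show "(\<lambda>y. indicator ?T y * density_in d y) \<in> borel_measurable borel"
      by (rule meas[OF d B(3)])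
    show "(\<lambda>x. indicator ?S x * (\<bar>det (matrix (?t' x))\<bar> * density_in d (transition c d x))) \<in> borel_measurable borel"
      unfolding dens by (rule meas[OF c B(2)])
  qed
  moreover have "ennreal (indicator X y * r) = ennreal r * indicator X y" for X r and y :: "real^'n"
    by (simp add: indicator_def)
  ultimately show ?thesis unfolding dens chart_volume_def by simp
qed

text \<open>The part of the volume that lies in one chart domain, as a measure on \<open>M\<close>. Countable
  additivity, and later integration in a chart, are inherited from it.\<close>

definition chart_measure :: "('a, 'n) chart \<Rightarrow> 'a measure" where
  "chart_measure c = distr (density (restrict_space lborel (chart_img c)) (\<lambda>x. ennreal (density_in c x)))
     (restrict_space borel M) (chart_inv c)"

lemma sets_chart_measure [simp]: "sets (chart_measure c) = sets (restrict_space borel M)"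
  by (simp add: chart_measure_def)

lemma borel_subset_M: "B \<in> sets (restrict_space borel M) \<longleftrightarrow> B \<in> sets borel \<and> B \<subseteq> M"
  using sets_restrict_space_iff[of M borel] by auto

lemma chart_inv_measurable_lborel:
  "c \<in> A \<Longrightarrow> chart_inv c \<in> measurable (restrict_space lborel (chart_img c)) (restrict_space borel M)"
  using chart_inv_measurable[of c] measurable_cong_sets[OF sets_restrict_space_cong[of lborel borel] refl] by auto

lemma density_measurable_lborel:
  "c \<in> A \<Longrightarrow> density_in c \<in> borel_measurable (restrict_space lborel (chart_img c))"
  using density_measurable[of c] measurable_cong_sets[OF sets_restrict_space_cong[of lborel borel] refl] by auto

lemma emeasure_chart_measure:
  assumes c: "c \<in> A" and B: "B \<in> sets borel" "B \<subseteq> M"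
  shows "emeasure (chart_measure c) B = chart_volume c (B \<inter> chart_dom c)"
proof -
  let ?L = "restrict_space lborel (chart_img c)"
  note [measurable] = chart_inv_measurable_lborel[OF c] density_measurable_lborel[OF c]
  have img: "chart_map c ` (B \<inter> chart_dom c) = chart_inv c -` B \<inter> chart_img c"
    by (subst chart_image_eq[OF c]) (use c chart_inv_in in auto)
  have mB: "chart_inv c -` B \<inter> chart_img c \<in> sets borel"
    using chart_image_borel[OF c, of "B \<inter> chart_dom c"] B(1) chart_dom_borel[OF c] img by auto
  have "emeasure (chart_measure c) B
      = emeasure (density ?L (\<lambda>x. ennreal (density_in c x))) (chart_inv c -` B \<inter> chart_img c)"
    unfolding chart_measure_def using B borel_subset_M
    by (subst emeasure_distr) (auto simp: space_restrict_space)
  also have "\<dots> = (\<integral>\<^sup>+x. ennreal (density_in c x) * indicator (chart_inv c -` B \<inter> chart_img c) x \<partial>?L)"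
    using mB chart_img_borel[OF c] by (subst emeasure_density) (auto simp: sets_restrict_space_iff)
  also have "\<dots> = (\<integral>\<^sup>+x. ennreal (density_in c x) * indicator (chart_inv c -` B \<inter> chart_img c) x * indicator (chart_img c) x \<partial>lborel)"
    using chart_img_borel[OF c] by (subst nn_integral_restrict_space) auto
  also have "\<dots> = chart_volume c (B \<inter> chart_dom c)"
    unfolding chart_volume_def img by (intro nn_integral_cong) (auto simp: indicator_def)
  finally show ?thesis .
qed

text \<open>The property by which \<open>riemannian_volume\<close> is described, restated as a predicate.\<close>

definition is_volume :: "'a measure \<Rightarrow> bool" where
  "is_volume \<mu> \<longleftrightarrow> sets \<mu> = sets (restrict_space borel M) \<and>
     (\<forall>c\<in>A. \<forall>B\<in>sets \<mu>. B \<subseteq> chart_dom c \<longrightarrow> emeasure \<mu> B = chart_volume c B)"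

text \<open>Finitely many charts cover \<open>M\<close>. They are enumerated by the natural numbers, with repetitions,
  so that countable sums can be used throughout. If \<open>M\<close> is empty there may be no chart at all, so that \<open>F k\<close> is
  claimed to lie in the atlas only where \<open>P k\<close> is not empty.\<close>

lemma countable_disjoint_cover:
  obtains F P where "\<And>k::nat. P k \<noteq> {} \<Longrightarrow> F k \<in> A" "\<And>k. P k \<subseteq> chart_dom (F k)"
    "\<And>k. P k \<in> sets borel" "disjoint_family P" "(\<Union>k. P k) = M"
proof (cases "M = {}")
  case True
  then show ?thesis using that[of "\<lambda>_. {}" undefined] by (simp add: disjoint_family_on_def)
next
  case False
  obtain D where D: "D \<subseteq> A" "finite D" "M = (\<Union>c\<in>D. chart_dom c)"
  proof -
    have "\<forall>c\<in>A. \<exists>T. open T \<and> chart_dom c = M \<inter> T"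
      using chart_dom_openin by (auto simp: openin_open)
    then obtain T where T: "\<And>c. c \<in> A \<Longrightarrow> open (T c)" "\<And>c. c \<in> A \<Longrightarrow> chart_dom c = M \<inter> T c" by metis
    have "M \<subseteq> (\<Union>c\<in>A. T c)" using M_eq T(2) by auto
    then obtain D where "D \<subseteq> A" "finite D" "M \<subseteq> (\<Union>c\<in>D. T c)"
      using compactE_image[OF compact_M, of A T] T(1) by metis
    with T(2) that show ?thesis by (metis (no_types, lifting) Int_UN_distrib Int_absorb2 SUP_cong subsetD)
  qed
  have "D \<noteq> {}" using D(3) False by auto
  define F where "F = from_nat_into D"
  have F: "F k \<in> D" for k using from_nat_into[OF \<open>D \<noteq> {}\<close>] by (simp add: F_def)
  have "range F = D"
    using range_from_nat_into[OF \<open>D \<noteq> {}\<close> countable_finite[OF D(2)]] by (simp add: F_def)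
  then have cov: "(\<Union>k. chart_dom (F k)) = M" using D(3) by (metis image_image)
  show ?thesis
  proof (rule that[of "disjointed (\<lambda>k. chart_dom (F k))" F])
    show "F k \<in> A" for k using F D(1) by blast
    show "disjointed (\<lambda>k. chart_dom (F k)) k \<subseteq> chart_dom (F k)" for k
      by (rule disjointed_subset)
    show "disjointed (\<lambda>k. chart_dom (F k)) k \<in> sets borel" for k
      using F D(1) chart_dom_borel unfolding disjointed_def by (intro sets.Diff sets.finite_UN) blast+
    show "(\<Union>k. disjointed (\<lambda>k. chart_dom (F k)) k) = M" by (simp add: UN_disjointed_eq cov)
  qed (rule disjoint_family_disjointed)
qed

lemma chart_volume_empty [simp]: "chart_volume c {} = 0"
  by (simp add: chart_volume_def)

text \<open>Cut a set along a disjoint cover. Each piece lies in one chart, so its volume is prescribed,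
  which gives uniqueness. The sum of the prescribed volumes is a measure, and by
  \<open>chart_volume_eq\<close> it has the prescribed value in every chart, not only in those of the cover.\<close>

lemma is_volume_ex1: "\<exists>!\<mu>. is_volume \<mu>"
proof -
  obtain F P where P: "\<And>k::nat. P k \<noteq> {} \<Longrightarrow> F k \<in> A" "\<And>k. P k \<subseteq> chart_dom (F k)"
    "\<And>k. P k \<in> sets borel" "disjoint_family P" "(\<Union>k. P k) = M"
    using countable_disjoint_cover by metis
  let ?R = "restrict_space borel M"
  have PR: "B \<inter> P k \<in> sets ?R" if "B \<in> sets ?R" for B k
    using that P(3)[of k] by (auto simp: borel_subset_M)
  have disj: "disjoint_family (\<lambda>k. B \<inter> P k)" for B using P(4) by (auto simp: disjoint_family_on_def)
  have UP: "(\<Union>k. B \<inter> P k) = B" if "B \<in> sets ?R" for B using that P(5) by (auto simp: borel_subset_M)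
  define v where "v B = (\<Sum>k. chart_volume (F k) (B \<inter> P k))" for B
  have v: "v B = (\<Sum>k. emeasure (chart_measure (F k)) (B \<inter> P k))" if "B \<in> sets ?R" for B
    unfolding v_def
  proof (rule suminf_cong)
    fix k
    show "chart_volume (F k) (B \<inter> P k) = emeasure (chart_measure (F k)) (B \<inter> P k)"
    proof (cases "P k = {}")
      case False
      have "B \<inter> P k \<inter> chart_dom (F k) = B \<inter> P k" using P(2) by auto
      then show ?thesis
        using emeasure_chart_measure[OF P(1)[OF False], of "B \<inter> P k"] PR[OF that, of k]
        by (simp add: borel_subset_M)
    qed simp
  qed
  have eq: "emeasure \<mu> B = v B" if "is_volume \<mu>" "B \<in> sets \<mu>" for \<mu> B
  proof -
    have s: "sets \<mu> = sets ?R" and vol: "\<And>c B. c \<in> A \<Longrightarrow> B \<in> sets \<mu> \<Longrightarrow> B \<subseteq> chart_dom c \<Longrightarrow> emeasure \<mu> B = chart_volume c B"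
      using that(1) by (auto simp: is_volume_def)
    have "emeasure \<mu> B = (\<Sum>k. emeasure \<mu> (B \<inter> P k))"
      using suminf_emeasure[of "\<lambda>k. B \<inter> P k" \<mu>] disj UP[of B] PR[of B] that(2) s
      by (simp add: image_subset_iff)
    also have "\<dots> = v B" unfolding v_def
    proof (rule suminf_cong)
      fix k
      show "emeasure \<mu> (B \<inter> P k) = chart_volume (F k) (B \<inter> P k)"
      proof (cases "P k = {}")
        case False
        then show ?thesis using P(1,2)[of k] PR[of B k] that(2) s by (intro vol) auto
      qed simp
    qed
    finally show ?thesis .
  qed
  have RM: "sets ?R \<subseteq> Pow M" by (auto simp: borel_subset_M)
  define \<mu> where "\<mu> = measure_of M (sets ?R) v"
  have sets\<mu>: "sets \<mu> = sets ?R"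
    unfolding \<mu>_def using sets.sigma_algebra_axioms[of ?R]
    by (simp add: space_restrict_space sets_measure_of_conv sigma_algebra.sigma_sets_eq RM)
  have v\<mu>: "emeasure \<mu> B = v B" if "B \<in> sets ?R" for B
  proof (rule emeasure_measure_of[OF \<mu>_def])
    show "sets ?R \<subseteq> Pow M" by (rule RM)
    show "B \<in> sets \<mu>" using that sets\<mu> by simp
    show "positive (sets \<mu>) v" by (simp add: positive_def v_def)
    show "countably_additive (sets \<mu>) v"
      unfolding sets\<mu>
    proof (rule countably_additiveI)
      fix B :: "nat \<Rightarrow> 'a set" assume B: "range B \<subseteq> sets ?R" "disjoint_family B" "(\<Union>i. B i) \<in> sets ?R"
      then have Bi: "B i \<in> sets ?R" for i by auto
      have "(\<Sum>i. v (B i)) = (\<Sum>i. \<Sum>k. emeasure (chart_measure (F k)) (B i \<inter> P k))"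
        using v[OF Bi] by simp
      \<comment> \<open>A sum over the natural numbers is an integral for the counting measure, so the two sums may be
        interchanged.\<close>
      also have "\<dots> = (\<integral>\<^sup>+k. (\<Sum>i. emeasure (chart_measure (F k)) (B i \<inter> P k)) \<partial>count_space UNIV)"
        by (subst nn_integral_suminf) (simp_all add: nn_integral_count_space_nat)
      also have "\<dots> = (\<Sum>k. \<Sum>i. emeasure (chart_measure (F k)) (B i \<inter> P k))"
        by (simp add: nn_integral_count_space_nat)
      also have "\<dots> = (\<Sum>k. emeasure (chart_measure (F k)) ((\<Union>i. B i) \<inter> P k))"
      proof (rule suminf_cong)
        fix k
        have "(\<Sum>i. emeasure (chart_measure (F k)) (B i \<inter> P k)) = emeasure (chart_measure (F k)) (\<Union>i. B i \<inter> P k)"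
        proof (rule suminf_emeasure)
          show "range (\<lambda>i. B i \<inter> P k) \<subseteq> sets (chart_measure (F k))" using PR[OF Bi] by auto
          show "disjoint_family (\<lambda>i. B i \<inter> P k)" using B(2) unfolding disjoint_family_on_def by blast
        qed
        then show "(\<Sum>i. emeasure (chart_measure (F k)) (B i \<inter> P k)) = emeasure (chart_measure (F k)) ((\<Union>i. B i) \<inter> P k)"
          by simp
      qed
      also have "\<dots> = v (\<Union>i. B i)" using v[OF B(3)] by simp
      finally show "(\<Sum>i. v (B i)) = v (\<Union>i. B i)" .
    qed
  qed
  have "emeasure \<mu> B = chart_volume c B" if c: "c \<in> A" and B: "B \<in> sets ?R" "B \<subseteq> chart_dom c" for c B
  proof -
    have sub: "B \<inter> P k \<inter> chart_dom c = B \<inter> P k" for k using B(2) by auto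
    have "v B = (\<Sum>k. emeasure (chart_measure c) (B \<inter> P k))" unfolding v_def
    proof (rule suminf_cong)
      fix k
      show "chart_volume (F k) (B \<inter> P k) = emeasure (chart_measure c) (B \<inter> P k)"
      proof (cases "P k = {}")
        case False
        have "chart_volume (F k) (B \<inter> P k) = chart_volume c (B \<inter> P k)"
          using P(1)[OF False] c PR[OF B(1), of k] P(2)[of k] B(2)
          by (intro chart_volume_eq) (auto simp: borel_subset_M)
        then show ?thesis
          using emeasure_chart_measure[OF c, of "B \<inter> P k"] PR[OF B(1), of k] sub[of k]
          by (simp add: borel_subset_M)
      qed simp
    qed
    also have "\<dots> = emeasure (chart_measure c) B"
      using suminf_emeasure[of "\<lambda>k. B \<inter> P k" "chart_measure c"] disj UP[OF B(1)] PR[OF B(1)]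
      by (simp add: image_subset_iff)
    also have "\<dots> = chart_volume c B"
      using emeasure_chart_measure[OF c, of B] B by (simp add: borel_subset_M Int_absorb2)
    finally show ?thesis using v\<mu>[OF B(1)] by simp
  qed
  then have "is_volume \<mu>" by (simp add: is_volume_def sets\<mu>)
  moreover have "\<nu> = \<mu>" if "is_volume \<nu>" for \<nu>
    using that calculation sets\<mu> eq by (intro measure_eqI) (auto simp: is_volume_def)
  ultimately show ?thesis by blast
qed

abbreviation vol :: "'a measure" where "vol \<equiv> riemannian_volume M A g"

lemma is_volume_vol: "is_volume vol"
proof -
  have "vol = (THE \<mu>. is_volume \<mu>)"
    by (simp add: riemannian_volume_def is_volume_def[abs_def] chart_volume_def)
  then show ?thesis using theI'[OF is_volume_ex1] by simp
qed

lemma sets_vol [simp, measurable_cong]: "sets vol = sets (restrict_space borel M)"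
  using is_volume_vol by (simp add: is_volume_def)

lemma space_vol [simp]: "space vol = M"
  using sets_eq_imp_space_eq[OF sets_vol] by (simp add: space_restrict_space)

lemma chart_measure_eq_density:
  assumes c: "c \<in> A"
  shows "chart_measure c = density vol (\<lambda>p. ennreal (indicator (chart_dom c) p))"
proof (rule measure_eqI)
  have m: "chart_dom c \<in> sets vol"
    using chart_dom_borel[OF c] chart_dom_subset[OF c] by (simp add: borel_subset_M)
  fix B assume "B \<in> sets (chart_measure c)"
  then have B: "B \<in> sets (restrict_space borel M)" by simp
  have BU: "B \<inter> chart_dom c \<in> sets vol" using B m by auto
  have "emeasure (density vol (\<lambda>p. ennreal (indicator (chart_dom c) p))) B
      = (\<integral>\<^sup>+p. ennreal (indicator (chart_dom c) p) * indicator B p \<partial>vol)"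
    using m B by (intro emeasure_density) auto
  also have "\<dots> = (\<integral>\<^sup>+p. indicator (B \<inter> chart_dom c) p \<partial>vol)"
    by (intro nn_integral_cong) (auto simp: indicator_def)
  also have "\<dots> = emeasure vol (B \<inter> chart_dom c)"
    using BU by simp
  also have "\<dots> = chart_volume c (B \<inter> chart_dom c)"
    using is_volume_vol c BU by (auto simp: is_volume_def)
  finally show "emeasure (chart_measure c) B = emeasure (density vol (\<lambda>p. ennreal (indicator (chart_dom c) p))) B"
    using emeasure_chart_measure[OF c, of B] B by (simp add: borel_subset_M)
qed simp

text \<open>Integration of a function that vanishes outside one chart domain. Both sides agree as
  Bochner integrals and the function may have either sign, so integrability has to be transferred too.\<close>

lemma integral_in_chart:
  fixes h :: "'a \<Rightarrow> real"
  assumes c: "c \<in> A" and h [measurable]: "h \<in> borel_measurable vol"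
    and supp: "\<And>p. p \<in> M \<Longrightarrow> p \<notin> chart_dom c \<Longrightarrow> h p = 0"
  shows "integrable vol h \<longleftrightarrow>
      integrable lborel (\<lambda>x. indicator (chart_img c) x *\<^sub>R (density_in c x * h (chart_inv c x)))"
    and "(\<integral>p. h p \<partial>vol) =
      (\<integral>x. indicator (chart_img c) x *\<^sub>R (density_in c x * h (chart_inv c x)) \<partial>lborel)"
proof -
  note m [measurable] = chart_inv_measurable_lborel[OF c] density_measurable_lborel[OF c]
  let ?L = "restrict_space lborel (chart_img c)"
  have dom [measurable]: "chart_dom c \<in> sets vol"
    using chart_dom_borel[OF c] chart_dom_subset[OF c] by (simp add: borel_subset_M)
  have hR [measurable]: "h \<in> borel_measurable (restrict_space borel M)"
    using h measurable_cong_sets[OF sets_vol refl] by blast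
  have ind: "indicator (chart_dom c) p *\<^sub>R h p = h p" if "p \<in> space vol" for p
    using supp that by (auto simp: indicator_def)
  have nn: "AE x in ?L. 0 \<le> density_in c x"
    using metric_det_pos[OF c] by (intro AE_I2) (auto simp: space_restrict_space less_imp_le)
  have comp: "(\<lambda>x. h (chart_inv c x)) \<in> borel_measurable ?L" by measurable
  have V: "chart_img c \<inter> space lborel \<in> sets lborel" using chart_img_borel[OF c] by simp
  have "integrable vol h \<longleftrightarrow> integrable vol (\<lambda>p. indicator (chart_dom c) p *\<^sub>R h p)"
    by (rule Bochner_Integration.integrable_cong[OF refl]) (erule ind[symmetric])
  also have "\<dots> \<longleftrightarrow> integrable (chart_measure c) h"
    unfolding chart_measure_eq_density[OF c] by (rule integrable_density[symmetric]) auto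
  also have "\<dots> \<longleftrightarrow> integrable (density ?L (\<lambda>x. ennreal (density_in c x))) (\<lambda>x. h (chart_inv c x))"
    unfolding chart_measure_def by (rule integrable_distr_eq) auto
  also have "\<dots> \<longleftrightarrow> integrable ?L (\<lambda>x. density_in c x *\<^sub>R h (chart_inv c x))"
    by (rule integrable_density[OF comp m(2) nn])
  also have "\<dots> \<longleftrightarrow> integrable lborel (\<lambda>x. indicator (chart_img c) x *\<^sub>R (density_in c x * h (chart_inv c x)))"
    using integrable_restrict_space[OF V, of "\<lambda>x. density_in c x * h (chart_inv c x)"] by (simp add: set_integrable_def)
  finally show "integrable vol h \<longleftrightarrow>
      integrable lborel (\<lambda>x. indicator (chart_img c) x *\<^sub>R (density_in c x * h (chart_inv c x)))" .
  have "(\<integral>p. h p \<partial>vol) = (\<integral>p. indicator (chart_dom c) p *\<^sub>R h p \<partial>vol)"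
    by (rule Bochner_Integration.integral_cong[OF refl]) (erule ind[symmetric])
  also have "\<dots> = (\<integral>p. h p \<partial>chart_measure c)"
    unfolding chart_measure_eq_density[OF c] by (rule integral_density[symmetric]) auto
  also have "\<dots> = (\<integral>x. h (chart_inv c x) \<partial>density ?L (\<lambda>x. ennreal (density_in c x)))"
    unfolding chart_measure_def by (rule integral_distr) auto
  also have "\<dots> = (\<integral>x. density_in c x *\<^sub>R h (chart_inv c x) \<partial>?L)"
    by (rule integral_density[OF comp m(2) nn])
  also have "\<dots> = (\<integral>x. indicator (chart_img c) x *\<^sub>R (density_in c x * h (chart_inv c x)) \<partial>lborel)"
    using integral_restrict_space[OF V, of "\<lambda>x. density_in c x * h (chart_inv c x)"] by (simp add: set_lebesgue_integral_def)
  finally show "(\<integral>p. h p \<partial>vol) =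
      (\<integral>x. indicator (chart_img c) x *\<^sub>R (density_in c x * h (chart_inv c x)) \<partial>lborel)" .
qed

end

section \<open>Differentiable functions and the divergence on the manifold\<close>

context closed_riemannian_manifold
begin

lemma chart_at_in:
  assumes "p \<in> M"
  shows "chart_at A p \<in> A" "p \<in> chart_dom (chart_at A p)"
proof -
  have "\<exists>c. c \<in> A \<and> p \<in> chart_dom c" using assms M_eq by auto
  from someI_ex[OF this] show "chart_at A p \<in> A" "p \<in> chart_dom (chart_at A p)"
    by (auto simp: chart_at_def)
qed

definition Ck_function :: "nat \<Rightarrow> ('a \<Rightarrow> real) \<Rightarrow> bool" where
  "Ck_function k h \<longleftrightarrow> (\<forall>c\<in>A. Ck_on k (chart_img c) (h \<circ> chart_inv c))"

lemma Ck_functionD: "Ck_function k h \<Longrightarrow> c \<in> A \<Longrightarrow> Ck_on k (chart_img c) (h \<circ> chart_inv c)"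
  by (simp add: Ck_function_def)

lemma Ck_function_differentiable:
  "Ck_function (Suc k) h \<Longrightarrow> c \<in> A \<Longrightarrow> x \<in> chart_img c \<Longrightarrow> (h \<circ> chart_inv c) differentiable (at x)"
  by (auto simp: Ck_function_def)

lemma Ck_function_Suc_D: "Ck_function (Suc k) h \<Longrightarrow> Ck_function k h"
  unfolding Ck_function_def using Ck_on_Suc_D by blast

lemma Ck_function_mult:
  "Ck_function k h \<Longrightarrow> Ck_function k h' \<Longrightarrow> Ck_function k (\<lambda>p. h p * h' p)"
  unfolding Ck_function_def o_def by (simp add: Ck_on_mult open_chart_img)

lemma Ck_function_add:
  "Ck_function k h \<Longrightarrow> Ck_function k h' \<Longrightarrow> Ck_function k (\<lambda>p. h p + h' p)"
  unfolding Ck_function_def o_def by (simp add: Ck_on_add open_chart_img)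

lemma Ck_function_sum:
  "(\<And>i. i \<in> I \<Longrightarrow> Ck_function k (h i)) \<Longrightarrow> Ck_function k (\<lambda>p. \<Sum>i\<in>I. h i p)"
  unfolding Ck_function_def o_def by (simp add: Ck_on_sum open_chart_img)

lemma Ck_function_divide:
  assumes "Ck_function k h" "Ck_function k h'" "\<And>p. p \<in> M \<Longrightarrow> h' p \<noteq> 0"
  shows "Ck_function k (\<lambda>p. h p / h' p)"
  unfolding Ck_function_def o_def
proof
  fix c assume c: "c \<in> A"
  show "Ck_on k (chart_img c) (\<lambda>x. h (chart_inv c x) / h' (chart_inv c x))"
    using Ck_functionD[OF assms(1) c] Ck_functionD[OF assms(2) c] assms(3) chart_inv_in_M[OF c]
    by (intro Ck_on_divide open_chart_img[OF c]) (auto simp: o_def)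
qed

text \<open>Continuity in every chart is continuity on \<open>M\<close>, because chart domains are open in \<open>M\<close>.\<close>

lemma Ck_function_continuous:
  assumes "Ck_function 0 h"
  shows "continuous_on M h"
  unfolding continuous_on_eq_continuous_within
proof
  fix p assume "p \<in> M"
  then obtain c where c: "c \<in> A" "p \<in> chart_dom c" using M_eq by auto
  obtain T where T: "open T" "chart_dom c = M \<inter> T"
    using chart_dom_openin[OF c(1)] by (auto simp: openin_open)
  have "continuous_on (chart_dom c) (\<lambda>q. (h \<circ> chart_inv c) (chart_map c q))"
    by (rule continuous_on_compose2[OF Ck_functionD[OF assms c(1), unfolded Ck_on.simps]
          continuous_on_chart_map[OF c(1)]]) (use chart_map_in[OF c(1)] in auto)
  then have "continuous_on (chart_dom c) h"
    by (rule continuous_on_eq) (use c in auto)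
  then have "continuous (at p within chart_dom c) h"
    using c(2) continuous_on_eq_continuous_within by blast
  moreover have "at p within chart_dom c = at p within M"
    by (rule at_within_nhd[of p T]) (use T c in auto)
  ultimately show "continuous (at p within M) h" by simp
qed

lemma Ck_function_measurable [measurable]:
  assumes "Ck_function 0 h"
  shows "h \<in> borel_measurable vol"
  using borel_measurable_continuous_on_restrict[OF Ck_function_continuous[OF assms]]
    measurable_cong_sets[OF sets_vol refl] by blast

text \<open>Invariantly defined functions enter through this lemma: their definition uses the chart
  selected by \<open>chart_at\<close>, which varies from point to point, so regularity can only be read off from
  an expression that is valid throughout each chart.\<close>

lemma Ck_function_if_in_charts:
  assumes "\<And>c x. c \<in> A \<Longrightarrow> x \<in> chart_img c \<Longrightarrow> h (chart_inv c x) = r c x"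
    and "\<And>c. c \<in> A \<Longrightarrow> Ck_on k (chart_img c) (r c)"
  shows "Ck_function k h"
  unfolding Ck_function_def
proof
  fix c assume c: "c \<in> A"
  show "Ck_on k (chart_img c) (h \<circ> chart_inv c)"
    by (rule Ck_on_cong[OF open_chart_img[OF c], THEN iffD2, OF _ assms(2)[OF c]]) (simp add: assms(1) c)
qed

end

locale vector_field_on_manifold = closed_riemannian_manifold M A g
  for M :: "'a::{t2_space,second_countable_topology} set"
    and A :: "('a, 'n::finite) chart set"
    and g :: "('a, 'n) tensor2" +
  fixes X :: "('a, 'n) vfield"
  assumes X: "smooth_vector_field A X"
begin

lemma X_smooth: "c \<in> A \<Longrightarrow> Ck_on k (chart_img c) (\<lambda>x. X c x $ i)"
  using X by (auto simp: smooth_vector_field_def smooth_on_def)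

lemma X_transition:
  "c \<in> A \<Longrightarrow> d \<in> A \<Longrightarrow> x \<in> chart_map c ` (chart_dom c \<inter> chart_dom d) \<Longrightarrow>
    X d (transition c d x) = transition_matrix c d x *v X c x"
  using X unfolding smooth_vector_field_def by blast

text \<open>The derivative of a function along a vector field does not depend on the chart: the chain rule
  and the transformation law of the vector field produce the same Jacobian matrix.\<close>

lemma derivative_transition:
  assumes c: "c \<in> A" and d: "d \<in> A" and x: "x \<in> chart_map c ` (chart_dom c \<inter> chart_dom d)"
    and h: "(h \<circ> chart_inv d) differentiable (at (transition c d x))"
  shows "(\<Sum>i\<in>UNIV. X c x $ i * partial i (h \<circ> chart_inv c) x)
    = (\<Sum>i\<in>UNIV. X d (transition c d x) $ i * partial i (h \<circ> chart_inv d) (transition c d x))"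
proof -
  let ?J = "transition_matrix c d x"
  have tau: "(\<lambda>x. transition c d x $ j) differentiable (at x)" for j
    using transition_smooth[OF c d, of 1 j, unfolded One_nat_def Ck_on.simps] x by blast
  have P: "partial i (h \<circ> chart_inv c) x
      = (\<Sum>j\<in>UNIV. partial j (h \<circ> chart_inv d) (transition c d x) * ?J $ j $ i)" for i
  proof -
    have "partial i (h \<circ> chart_inv c) x = partial i (\<lambda>y. (h \<circ> chart_inv d) (transition c d y)) x"
      by (rule partial_cong[OF open_overlap[OF c d] x]) (simp add: transition_in_overlap(3)[OF c d])
    also have "\<dots> = (\<Sum>j\<in>UNIV. partial j (h \<circ> chart_inv d) (transition c d x) * ?J $ j $ i)"
      by (subst partial_compose[OF tau h]) (simp add: transition_has_derivative(2)[OF c d x])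
    finally show ?thesis .
  qed
  have "(\<Sum>i\<in>UNIV. X c x $ i * partial i (h \<circ> chart_inv c) x)
    = (\<Sum>i\<in>UNIV. \<Sum>j\<in>UNIV. (?J $ j $ i * X c x $ i) * partial j (h \<circ> chart_inv d) (transition c d x))"
    unfolding P by (simp add: sum_distrib_left mult_ac)
  also have "\<dots> = (\<Sum>j\<in>UNIV. (?J *v X c x) $ j * partial j (h \<circ> chart_inv d) (transition c d x))"
    by (subst sum.swap) (simp add: matrix_vector_mult_def sum_distrib_right)
  finally show ?thesis by (simp add: X_transition[OF c d x])
qed

lemma vf_apply_in_chart:
  assumes h: "Ck_function (Suc k) h" and c: "c \<in> A" and x: "x \<in> chart_img c"
  shows "vf_apply A X h (chart_inv c x) = (\<Sum>i\<in>UNIV. X c x $ i * partial i (h \<circ> chart_inv c) x)"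
proof -
  define p d where "p = chart_inv c x" and "d = chart_at A p"
  have p: "p \<in> M" using chart_inv_in_M[OF c x] by (simp add: p_def)
  have d: "d \<in> A" "p \<in> chart_dom d" using chart_at_in[OF p] by (auto simp: d_def)
  have x': "x \<in> chart_map c ` (chart_dom c \<inter> chart_dom d)"
    using c x d(2) by (auto simp: p_def image_iff intro!: bexI[of _ "chart_inv c x"])
  have t: "transition c d x = chart_map d p" by (simp add: transition_def p_def)
  have "(h \<circ> chart_inv d) differentiable (at (transition c d x))"
    using Ck_function_differentiable[OF h d(1)] d by (simp add: t)
  from derivative_transition[OF c d(1) x' this] show ?thesis
    by (simp add: vf_apply_def Let_def t flip: p_def d_def)
qed

lemma Ck_function_vf_apply:
  assumes h: "Ck_function (Suc k) h"
  shows "Ck_function k (vf_apply A X h)"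
proof (rule Ck_function_if_in_charts[where r = "\<lambda>c x. \<Sum>i\<in>UNIV. X c x $ i * partial i (h \<circ> chart_inv c) x"])
  fix c assume c: "c \<in> A"
  show "vf_apply A X h (chart_inv c x) = (\<Sum>i\<in>UNIV. X c x $ i * partial i (h \<circ> chart_inv c) x)"
    if "x \<in> chart_img c" for x
    by (rule vf_apply_in_chart[OF h c that])
  show "Ck_on k (chart_img c) (\<lambda>x. \<Sum>i\<in>UNIV. X c x $ i * partial i (h \<circ> chart_inv c) x)"
    using Ck_functionD[OF h c] by (intro Ck_on_sum Ck_on_mult open_chart_img c X_smooth) simp
qed

text \<open>Let \<open>J\<close> be the Jacobian matrix of the transition map. Differentiating \<open>Y \<circ> t = J X\<close>, where \<open>Y\<close> is the
  field in the second chart, gives \<open>DY J = J DX + E\<close>. Since second derivatives commute, \<open>E\<close> is the derivative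
  of \<open>J\<close> in direction \<open>X\<close>. Conjugating by \<open>J\<close> and taking traces, \<open>tr DY = tr DX + tr (J\<^sup>-\<^sup>1 E)\<close>. On the other
  hand \<open>det g = (det J)\<^sup>2 (det g' \<circ> t)\<close>, so passing to the second chart removes the term
  \<open>X(det J) / det J\<close>, which is also \<open>tr (J\<^sup>-\<^sup>1 E)\<close> by Jacobi's formula. The two changes cancel.\<close>

lemma coord_divergence_transition:
  assumes c: "c \<in> A" and d: "d \<in> A" and x: "x \<in> chart_map c ` (chart_dom c \<inter> chart_dom d)"
  shows "coord_divergence (X c) (g c) x = coord_divergence (X d) (g d) (transition c d x)"
proof -
  let ?O = "chart_map c ` (chart_dom c \<inter> chart_dom d)" and ?t = "transition c d"
  let ?J = "transition_matrix c d" and ?K = "matrix_inv (transition_matrix c d x)"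
  note O = open_overlap[OF c d]
  note tin = transition_in_overlap[OF c d]
  have xc: "x \<in> chart_img c" and xd: "?t x \<in> chart_img d" using tin(4,5) x by auto
  have diff: "f differentiable (at y)" if "Ck_on 1 S f" "y \<in> S" for f and S :: "(real^'b) set" and y
    using that by simp
  have tau: "(\<lambda>x. ?t x $ j) differentiable (at x)" for j
    by (rule diff[OF transition_smooth[OF c d] x])
  have dX: "(\<lambda>y. X c y $ j) differentiable (at x)" for j by (rule diff[OF X_smooth[OF c] xc])
  have dY: "(\<lambda>y. X d y $ j) differentiable (at (?t x))" for j by (rule diff[OF X_smooth[OF d] xd])
  have J_partial: "?J y $ j $ k = partial k (\<lambda>z. ?t z $ j) y" if "y \<in> ?O" for y j k
    by (rule transition_has_derivative(2)[OF c d that])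
  have J_smooth: "Ck_on 1 ?O (\<lambda>y. ?J y $ j $ k)" for j k
  proof -
    have "Ck_on 1 ?O (partial k (\<lambda>z. ?t z $ j))"
      using transition_smooth[OF c d, of 2 j] by (simp add: numeral_2_eq_2)
    moreover have "Ck_on 1 ?O (\<lambda>y. ?J y $ j $ k) \<longleftrightarrow> Ck_on 1 ?O (partial k (\<lambda>z. ?t z $ j))"
      by (rule Ck_on_cong[OF O]) (rule J_partial)
    ultimately show ?thesis by simp
  qed
  have dJ: "(\<lambda>y. ?J y $ j $ k) differentiable (at x)" for j k by (rule diff[OF J_smooth x])
  have J_sym: "partial i (\<lambda>y. ?J y $ j $ k) x = partial k (\<lambda>y. ?J y $ j $ i) x" for i j k
  proof -
    have "partial i (\<lambda>y. ?J y $ j $ k) x = partial i (partial k (\<lambda>z. ?t z $ j)) x"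
      by (rule partial_cong[OF O x J_partial])
    also have "\<dots> = partial k (partial i (\<lambda>z. ?t z $ j)) x"
      by (rule partial_commute[OF transition_smooth[OF c d] O x])
    also have "\<dots> = partial k (\<lambda>y. ?J y $ j $ i) x"
      by (rule partial_cong[OF O x J_partial, symmetric])
    finally show ?thesis .
  qed
  have detJ: "det (?J x) \<noteq> 0"
    using density_transition(2)[OF c d x] metric_det_pos[OF c xc] by auto
  then have invJ: "invertible (?J x)" using invertible_det_nz by blast

  define DX where "DX = (\<chi> k i. partial i (\<lambda>y. X c y $ k) x)"
  define DY where "DY = (\<chi> j l. partial l (\<lambda>y. X d y $ j) (?t x))"
  define E where "E = (\<chi> j i. \<Sum>k\<in>UNIV. X c x $ k * partial k (\<lambda>y. ?J y $ j $ i) x)"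

  have "DY ** ?J x = ?J x ** DX + E"
  proof -
    have "(DY ** ?J x) $ j $ i = (?J x ** DX + E) $ j $ i" for j i
    proof -
      have "(DY ** ?J x) $ j $ i = partial i (\<lambda>y. X d (?t y) $ j) x"
        by (subst partial_compose[OF tau dY])
          (simp add: DY_def matrix_matrix_mult_def J_partial[OF x])
      also have "\<dots> = partial i (\<lambda>y. \<Sum>k\<in>UNIV. ?J y $ j $ k * X c y $ k) x"
        by (rule partial_cong[OF O x]) (simp add: X_transition[OF c d] matrix_vector_mult_def)
      also have "\<dots> = (\<Sum>k\<in>UNIV. ?J x $ j $ k * partial i (\<lambda>y. X c y $ k) x
          + partial i (\<lambda>y. ?J y $ j $ k) x * X c x $ k)"
        using dJ dX by (subst partial_sum) (auto intro: differentiable_mult simp: partial_mult)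
      also have "\<dots> = (?J x ** DX + E) $ j $ i"
        unfolding DX_def E_def
        by (simp add: matrix_matrix_mult_def sum.distrib J_sym[of i j] mult.commute)
      finally show ?thesis .
    qed
    then show ?thesis by (simp add: vec_eq_iff)
  qed
  then have "?K ** (DY ** ?J x) = DX + ?K ** E"
    by (simp add: matrix_add_ldistrib matrix_mul_assoc matrix_inv_inverse[OF invJ])
  then have tr: "trace DY = trace DX + trace (?K ** E)"
    using trace_conjugate[OF invJ, of DY] by (simp add: trace_add)

  \<comment> \<open>This is Jacobi's formula for \<open>J\<close> in direction \<open>X\<close>.\<close>
  have trKE: "(\<Sum>k\<in>UNIV. X c x $ k * partial k (\<lambda>y. det (?J y)) x) = det (?J x) * trace (?K ** E)"
  proof -
    have "(\<Sum>k\<in>UNIV. X c x $ k * partial k (\<lambda>y. det (?J y)) x)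
      = det (?J x) * (\<Sum>k\<in>UNIV. \<Sum>a\<in>UNIV. \<Sum>b\<in>UNIV. ?K $ a $ b * (X c x $ k * partial k (\<lambda>y. ?J y $ b $ a) x))"
      by (simp add: partial_det[OF dJ invJ] trace_def matrix_matrix_mult_def sum_distrib_left mult_ac)
    also have "(\<Sum>k\<in>UNIV. \<Sum>a\<in>UNIV. \<Sum>b\<in>UNIV. ?K $ a $ b * (X c x $ k * partial k (\<lambda>y. ?J y $ b $ a) x))
      = (\<Sum>a\<in>UNIV. \<Sum>b\<in>UNIV. \<Sum>k\<in>UNIV. ?K $ a $ b * (X c x $ k * partial k (\<lambda>y. ?J y $ b $ a) x))"
      by (subst sum.swap, rule sum.cong[OF refl], rule sum.swap)
    also have "\<dots> = trace (?K ** E)"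
      by (simp add: trace_def matrix_matrix_mult_def E_def sum_distrib_left)
    finally show ?thesis .
  qed

  have "(\<Sum>k\<in>UNIV. X c x $ k * partial k (\<lambda>y. det (g c y)) x)
    = 2 * det (?J x) * det (g d (?t x)) * (\<Sum>k\<in>UNIV. X c x $ k * partial k (\<lambda>y. det (?J y)) x)
      + (det (?J x))\<^sup>2 * (\<Sum>l\<in>UNIV. X d (?t x) $ l * partial l (\<lambda>y. det (g d y)) (?t x))"
  proof -
    have ddJ: "(\<lambda>y. det (?J y)) differentiable (at x)"
      by (rule diff[OF Ck_on_det[OF O J_smooth] x])
    have ddg: "(\<lambda>y. det (g d y)) differentiable (at (?t x))"
      by (rule diff[OF metric_det_smooth[OF d] xd])
    have ddgt: "(\<lambda>y. det (g d (?t y))) differentiable (at x)"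
    proof (rule diff[OF _ x])
      show "Ck_on 1 ?O (\<lambda>y. det (g d (?t y)))"
        by (rule Ck_on_compose[OF O transition_smooth[OF c d] _ metric_det_smooth[OF d]]) (rule tin(5))
    qed
    have "partial k (\<lambda>y. det (g c y)) x = 2 * det (?J x) * det (g d (?t x)) * partial k (\<lambda>y. det (?J y)) x
      + (det (?J x))\<^sup>2 * (\<Sum>l\<in>UNIV. partial l (\<lambda>y. det (g d y)) (?t x) * ?J x $ l $ k)" for k
    proof -
      have "partial k (\<lambda>y. det (g c y)) x = partial k (\<lambda>y. (det (?J y) * det (?J y)) * det (g d (?t y))) x"
        by (rule partial_cong[OF O x]) (simp add: density_transition(2)[OF c d] power2_eq_square)
      also have "\<dots> = (det (?J x) * det (?J x)) * partial k (\<lambda>y. det (g d (?t y))) x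
          + (det (?J x) * partial k (\<lambda>y. det (?J y)) x + partial k (\<lambda>y. det (?J y)) x * det (?J x)) * det (g d (?t x))"
        by (simp add: partial_mult ddJ ddgt differentiable_mult)
      also have "partial k (\<lambda>y. det (g d (?t y))) x = (\<Sum>l\<in>UNIV. partial l (\<lambda>y. det (g d y)) (?t x) * ?J x $ l $ k)"
        by (subst partial_compose[OF tau ddg]) (simp add: J_partial[OF x])
      finally show ?thesis by (simp add: power2_eq_square algebra_simps)
    qed
    note P = this
    have "(\<Sum>k\<in>UNIV. X c x $ k * partial k (\<lambda>y. det (g c y)) x)
      = 2 * det (?J x) * det (g d (?t x)) * (\<Sum>k\<in>UNIV. X c x $ k * partial k (\<lambda>y. det (?J y)) x)
       + (det (?J x))\<^sup>2 * (\<Sum>k\<in>UNIV. \<Sum>l\<in>UNIV. X c x $ k * (partial l (\<lambda>y. det (g d y)) (?t x) * ?J x $ l $ k))"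
      unfolding P by (simp add: distrib_left sum.distrib sum_distrib_left mult_ac)
    also have "(\<Sum>k\<in>UNIV. \<Sum>l\<in>UNIV. X c x $ k * (partial l (\<lambda>y. det (g d y)) (?t x) * ?J x $ l $ k))
      = (\<Sum>l\<in>UNIV. X d (?t x) $ l * partial l (\<lambda>y. det (g d y)) (?t x))"
      by (subst sum.swap) (simp add: X_transition[OF c d x] matrix_vector_mult_def sum_distrib_left mult_ac)
    finally show ?thesis .
  qed
  then have "(\<Sum>k\<in>UNIV. X c x $ k * partial k (\<lambda>y. det (g c y)) x) / (2 * det (g c x))
    = trace (?K ** E) + (\<Sum>l\<in>UNIV. X d (?t x) $ l * partial l (\<lambda>y. det (g d y)) (?t x)) / (2 * det (g d (?t x)))"
    unfolding trKE using detJ metric_det_pos[OF d xd]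
    by (simp add: density_transition(2)[OF c d x] field_simps power2_eq_square)
  moreover have "trace DX = (\<Sum>i\<in>UNIV. partial i (\<lambda>y. X c y $ i) x)"
    "trace DY = (\<Sum>i\<in>UNIV. partial i (\<lambda>y. X d y $ i) (?t x))"
    by (simp_all add: trace_def DX_def DY_def)
  ultimately show ?thesis using tr by (simp add: coord_divergence_def)
qed

definition divergence :: "'a \<Rightarrow> real" where
  "divergence p = (let c = chart_at A p in coord_divergence (X c) (g c) (chart_map c p))"

lemma divergence_in_chart:
  assumes c: "c \<in> A" and x: "x \<in> chart_img c"
  shows "divergence (chart_inv c x) = coord_divergence (X c) (g c) x"
proof -
  define p d where "p = chart_inv c x" and "d = chart_at A p"
  have p: "p \<in> M" using chart_inv_in_M[OF c x] by (simp add: p_def)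
  have d: "d \<in> A" "p \<in> chart_dom d" using chart_at_in[OF p] by (auto simp: d_def)
  have x': "x \<in> chart_map c ` (chart_dom c \<inter> chart_dom d)"
    using c x d(2) by (auto simp: p_def image_iff intro!: bexI[of _ "chart_inv c x"])
  have t: "transition c d x = chart_map d p" by (simp add: transition_def p_def)
  from coord_divergence_transition[OF c d(1) x'] show ?thesis
    by (simp add: divergence_def Let_def t flip: p_def d_def)
qed

lemma Ck_function_divergence: "Ck_function k divergence"
proof (rule Ck_function_if_in_charts[where r = "\<lambda>c. coord_divergence (X c) (g c)"])
  fix c assume c: "c \<in> A"
  show "divergence (chart_inv c x) = coord_divergence (X c) (g c) x" if "x \<in> chart_img c" for x
    by (rule divergence_in_chart[OF c that])
  note V = open_chart_img[OF c]
  have 1: "Ck_on k (chart_img c) (partial i (\<lambda>y. X c y $ i))" for i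
    using X_smooth[OF c, of "Suc k" i] by simp
  have 2: "Ck_on k (chart_img c) (partial i (\<lambda>y. det (g c y)))" for i
    using metric_det_smooth[OF c, of "Suc k"] by simp
  show "Ck_on k (chart_img c) (coord_divergence (X c) (g c))"
    unfolding coord_divergence_def[abs_def] using metric_det_pos[OF c]
    by (intro Ck_on_add Ck_on_divide Ck_on_sum Ck_on_mult Ck_on_const V 1 2 X_smooth[OF c] metric_det_smooth[OF c])
      (auto simp: less_le)
qed

end

section \<open>Partitions of unity\<close>

text \<open>The square of the positive part is \<open>C\<^sup>1\<close>, which suffices for integration by parts.\<close>

definition square_pos :: "real \<Rightarrow> real" where
  "square_pos t = (max 0 t)\<^sup>2"

text \<open>The first order Taylor remainder is at most \<open>h\<^sup>2\<close>, whatever the signs of \<open>t\<close> and \<open>t + h\<close>.\<close>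

lemma square_pos_has_derivative: "(square_pos has_real_derivative 2 * max 0 t) (at t)"
proof -
  have bound: "norm ((square_pos (t + h) - square_pos t) / h - 2 * max 0 t) \<le> \<bar>h\<bar>" if "h \<noteq> 0" for h
  proof -
    have "\<bar>square_pos (t + h) - square_pos t - 2 * max 0 t * h\<bar> \<le> h\<^sup>2"
    proof (cases "t \<ge> 0"; cases "t + h \<ge> 0")
      assume "t \<ge> 0" "\<not> t + h \<ge> 0"
      then have e: "square_pos (t + h) - square_pos t - 2 * max 0 t * h = - (t * (t + h)) - t * h"
        by (simp add: square_pos_def power2_eq_square algebra_simps)
      have "h * h - (- (t * (t + h)) - t * h) = (t + h) * (t + h)" by (simp add: algebra_simps)
      moreover have "(t + h) * (t + h) \<ge> 0" by simp
      moreover have "- (t * (t + h)) \<ge> 0" "- (t * h) \<ge> 0"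
        using \<open>t \<ge> 0\<close> \<open>\<not> t + h \<ge> 0\<close> by (auto simp: mult_nonneg_nonpos)
      ultimately show ?thesis unfolding e power2_eq_square by linarith
    next
      assume "\<not> t \<ge> 0" "t + h \<ge> 0"
      then have "square_pos (t + h) - square_pos t - 2 * max 0 t * h = (t + h)\<^sup>2" "0 \<le> t + h" "t + h \<le> h"
        by (auto simp: square_pos_def)
      then show ?thesis by (simp add: power_mono)
    qed (auto simp: square_pos_def power2_eq_square algebra_simps)
    then have "\<bar>square_pos (t + h) - square_pos t - 2 * max 0 t * h\<bar> / \<bar>h\<bar> \<le> \<bar>h\<bar>"
      using that by (simp add: divide_le_eq power2_eq_square)
    then show ?thesis using that by (simp add: diff_divide_distrib flip: abs_divide)
  qed
  have "((\<lambda>h. (square_pos (t + h) - square_pos t) / h - 2 * max 0 t) \<longlongrightarrow> 0) (at 0)"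
  proof (rule Lim_null_comparison)
    show "\<forall>\<^sub>F h in at 0. norm ((square_pos (t + h) - square_pos t) / h - 2 * max 0 t) \<le> \<bar>h\<bar>"
      using bound by (auto simp: eventually_at intro: exI[of _ 1])
    show "((\<lambda>h::real. \<bar>h\<bar>) \<longlongrightarrow> 0) (at 0)" by (intro tendsto_rabs_zero tendsto_ident_at)
  qed
  then show ?thesis unfolding DERIV_def by (rule LIM_zero_cancel)
qed

definition bump :: "real^'n::finite \<Rightarrow> real \<Rightarrow> real^'n \<Rightarrow> real" where
  "bump a r x = square_pos (r\<^sup>2 - (norm (x - a))\<^sup>2)"

lemma bump_C1: "Ck_on 1 S (bump a r)" if "open S" for S :: "(real^'n::finite) set"
proof -
  \<comment> \<open>The function inside the square of the positive part, written with sums, products and constants only.\<close>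
  let ?u = "\<lambda>x::real^'n. r\<^sup>2 + (\<Sum>i\<in>UNIV. - 1 * ((x $ i + - (a $ i)) * (x $ i + - (a $ i))))"
  have u: "Ck_on k S ?u" for k
    by (intro Ck_on_add Ck_on_sum Ck_on_mult Ck_on_const Ck_on_component that)
  have b: "bump a r x = square_pos (?u x)" for x
  proof -
    have "(norm (x - a))\<^sup>2 = (\<Sum>i\<in>UNIV. (x $ i - a $ i) * (x $ i - a $ i))"
      by (simp add: power2_norm_eq_inner inner_vec_def)
    then show ?thesis by (simp add: bump_def sum_negf)
  qed
  have D: "(bump a r has_derivative (\<lambda>v. frechet_derivative ?u (at x) v * (2 * max 0 (?u x)))) (at x)"
    if "x \<in> S" for x
  proof -
    have "(?u has_derivative frechet_derivative ?u (at x)) (at x)"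
      using u[of 1] \<open>x \<in> S\<close> frechet_derivative_works by auto
    then have "((\<lambda>x. square_pos (?u x)) has_derivative (\<lambda>v. frechet_derivative ?u (at x) v * (2 * max 0 (?u x)))) (at x)"
      by (rule DERIV_compose_FDERIV[OF square_pos_has_derivative])
    then show ?thesis unfolding b .
  qed
  have "Ck_on 0 S (partial i (bump a r))" for i
  proof -
    have "Ck_on 0 S (\<lambda>x. partial i ?u x * (2 * max 0 (?u x)))"
      using u[of 0] u[of 1] by (auto intro!: continuous_intros simp del: of_nat_sum)
    then show ?thesis
      by (rule iffD2[OF Ck_on_cong[OF that], rotated])
        (simp only: has_derivative_imp_partial[OF D], simp only: partial_def)
  qed
  then show ?thesis using D differentiable_def by (auto simp: One_nat_def simp del: Ck_on.simps(1)) blast+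
qed

lemma bump_nonneg: "bump a r x \<ge> 0"
  and bump_pos: "x \<in> ball a r \<Longrightarrow> bump a r x > 0"
  and bump_outside: "x \<notin> ball a r \<Longrightarrow> 0 \<le> r \<Longrightarrow> bump a r x = 0"
proof -
  show "bump a r x \<ge> 0" by (simp add: bump_def square_pos_def)
  show "x \<in> ball a r \<Longrightarrow> bump a r x > 0"
    using power_strict_mono[of "norm (x - a)" r 2]
    by (simp add: bump_def square_pos_def dist_norm norm_minus_commute)
  show "x \<notin> ball a r \<Longrightarrow> 0 \<le> r \<Longrightarrow> bump a r x = 0"
    using power_mono[of r "norm (x - a)" 2]
    by (simp add: bump_def square_pos_def dist_norm norm_minus_commute)
qed

context closed_riemannian_manifold
begin

text \<open>The support condition concerns points of \<open>M\<close> only, since values outside \<open>M\<close> carry no information.\<close>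

definition supported_in :: "('a, 'n) chart \<Rightarrow> (real^'n) set \<Rightarrow> ('a \<Rightarrow> real) \<Rightarrow> bool" where
  "supported_in c K h \<longleftrightarrow> c \<in> A \<and> compact K \<and> K \<subseteq> chart_img c \<and>
     (\<forall>p\<in>M. p \<notin> chart_inv c ` K \<longrightarrow> h p = 0)"

lemma chart_inv_image_subset: "c \<in> A \<Longrightarrow> K \<subseteq> chart_img c \<Longrightarrow> chart_inv c ` K \<subseteq> chart_dom c"
  using chart_inv_in by blast

lemma chart_inv_notin_image:
  assumes c: "c \<in> A" and K: "K \<subseteq> chart_img c" and x: "x \<in> chart_img c" "x \<notin> K"
  shows "chart_inv c x \<notin> chart_inv c ` K"
proof
  assume "chart_inv c x \<in> chart_inv c ` K"
  then obtain y where "y \<in> K" "chart_inv c x = chart_inv c y" by blast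
  then have "x = y" using chart_map_inv[OF c x(1)] chart_map_inv[OF c, of y] K by auto
  with \<open>y \<in> K\<close> x(2) show False by simp
qed

lemma openin_complement_support:
  assumes "c \<in> A" "compact K" "K \<subseteq> chart_img c"
  shows "openin (top_of_set M) (M - chart_inv c ` K)"
proof -
  have "compact (chart_inv c ` K)"
    using assms continuous_on_subset[OF continuous_on_chart_inv[OF assms(1)]]
    by (intro compact_continuous_image) auto
  then show ?thesis
    by (metis Diff_eq compact_imp_closed open_Compl openin_open_Int)
qed

text \<open>Near a point of the chart domain the function is a composition with a transition map; near any
  other point it is zero, since the support is compact and hence closed.\<close>

lemma Ck_function_extend_by_zero:
  assumes s: "supported_in c K h" and h: "Ck_on k (chart_img c) (h \<circ> chart_inv c)"
  shows "Ck_function k h"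
  unfolding Ck_function_def
proof
  have c: "c \<in> A" and K: "compact K" "K \<subseteq> chart_img c"
    and h0: "\<And>p. p \<in> M \<Longrightarrow> p \<notin> chart_inv c ` K \<Longrightarrow> h p = 0"
    using s by (auto simp: supported_in_def)
  fix d assume d: "d \<in> A"
  show "Ck_on k (chart_img d) (h \<circ> chart_inv d)"
  proof (rule Ck_on_open_local)
    fix x assume x: "x \<in> chart_img d"
    show "\<exists>T. open T \<and> x \<in> T \<and> Ck_on k T (h \<circ> chart_inv d)"
    proof (cases "chart_inv d x \<in> chart_dom c")
      case True
      let ?O = "chart_map d ` (chart_dom d \<inter> chart_dom c)"
      have "Ck_on k ?O (\<lambda>y. (h \<circ> chart_inv c) (transition d c y))"
        by (rule Ck_on_compose[OF open_overlap[OF d c] transition_smooth[OF d c] _ h])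
          (rule transition_in_overlap(5)[OF d c])
      then have "Ck_on k ?O (h \<circ> chart_inv d)"
        by (rule iffD2[OF Ck_on_cong[OF open_overlap[OF d c]], rotated])
          (simp add: transition_in_overlap(3)[OF d c])
      moreover have "x \<in> ?O" using True x d by (auto simp: image_iff intro!: bexI[of _ "chart_inv d x"])
      ultimately show ?thesis using open_overlap[OF d c] by blast
    next
      case False
      let ?W = "M - chart_inv c ` K"
      let ?T = "chart_map d ` (chart_dom d \<inter> ?W)"
      have T: "open ?T" by (rule open_chart_image_Int[OF d openin_complement_support[OF c K]])
      have "Ck_on k ?T (h \<circ> chart_inv d)"
        by (rule iffD2[OF Ck_on_cong[OF T] Ck_on_const[of k ?T 0]]) (use h0 d in auto)
      moreover have "chart_inv d x \<in> chart_dom d \<inter> ?W"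
        using False K(2) c d x chart_inv_in_M by auto
      then have "x \<in> ?T" using x d by (metis chart_map_inv image_eqI)
      ultimately show ?thesis using T by blast
    qed
  qed
qed

definition chart_bump :: "('a, 'n) chart \<Rightarrow> real^'n \<Rightarrow> real \<Rightarrow> 'a \<Rightarrow> real" where
  "chart_bump c a r p = (if p \<in> chart_dom c then bump a r (chart_map c p) else 0)"

lemma chart_bump_supported_C1:
  assumes c: "c \<in> A" and r: "0 < r" "cball a r \<subseteq> chart_img c"
  shows "supported_in c (cball a r) (chart_bump c a r)" "Ck_function 1 (chart_bump c a r)"
proof -
  show s: "supported_in c (cball a r) (chart_bump c a r)"
    unfolding supported_in_def
  proof (intro conjI ballI impI)
    fix p assume p: "p \<in> M" "p \<notin> chart_inv c ` cball a r"
    show "chart_bump c a r p = 0"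
    proof (cases "p \<in> chart_dom c")
      case True
      have "chart_map c p \<notin> cball a r" using p(2) True c by (metis chart_inv_map image_eqI)
      then show ?thesis using bump_outside[of "chart_map c p" a r] r by (simp add: chart_bump_def)
    qed (simp add: chart_bump_def)
  qed (use c r in auto)
  have "Ck_on 1 (chart_img c) (chart_bump c a r \<circ> chart_inv c)"
    by (rule iffD2[OF Ck_on_cong[OF open_chart_img[OF c]] bump_C1[OF open_chart_img[OF c], of a r]])
      (simp add: chart_bump_def c)
  then show "Ck_function 1 (chart_bump c a r)" by (rule Ck_function_extend_by_zero[OF s])
qed

text \<open>The sets where the bump functions are positive are open and cover \<open>M\<close>. Finitely many suffice,
  and dividing these bump functions by their sum gives the partition. The index of each function
  records the chart and the compact set that contains its support.\<close>

lemma partition_of_unity: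
  obtains I :: "('a \<times> ('a, 'n) chart \<times> (real^'n) set) set" and \<phi> where
    "finite I" "\<And>i. i \<in> I \<Longrightarrow> Ck_function 1 (\<phi> i)"
    "\<And>p c K. (p, c, K) \<in> I \<Longrightarrow> supported_in c K (\<phi> (p, c, K))"
    "\<And>p. p \<in> M \<Longrightarrow> (\<Sum>i\<in>I. \<phi> i p) = 1"
proof -
  have "\<exists>c r. c \<in> A \<and> p \<in> chart_dom c \<and> 0 < r \<and> cball (chart_map c p) r \<subseteq> chart_img c" if p: "p \<in> M" for p
  proof -
    obtain c where c: "c \<in> A" "p \<in> chart_dom c" using p M_eq by auto
    then show ?thesis
      using open_chart_img[OF c(1)] chart_map_in[OF c] unfolding open_contains_cball by blast
  qed
  then obtain C R where C: "\<And>p. p \<in> M \<Longrightarrow> C p \<in> A" "\<And>p. p \<in> M \<Longrightarrow> p \<in> chart_dom (C p)"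
    and R: "\<And>p. p \<in> M \<Longrightarrow> 0 < R p" "\<And>p. p \<in> M \<Longrightarrow> cball (chart_map (C p) p) (R p) \<subseteq> chart_img (C p)"
    by metis
  define b where "b p = chart_bump (C p) (chart_map (C p) p) (R p)" for p
  define K where "K p = cball (chart_map (C p) p) (R p)" for p
  note bs = chart_bump_supported_C1[OF C(1) R, folded b_def K_def]
  have b_nonneg: "b p q \<ge> 0" for p q by (simp add: b_def chart_bump_def bump_nonneg)
  have W: "openin (top_of_set M) {q \<in> M. 0 < b p q}" if "p \<in> M" for p
  proof -
    have "continuous_on M (b p)"
      using Ck_function_continuous[OF Ck_function_Suc_D] bs(2)[OF that that that] by simp
    then have "openin (top_of_set M) (M \<inter> b p -` {0<..})"
      by (intro continuous_openin_preimage_gen) auto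
    moreover have "M \<inter> b p -` {0<..} = {q \<in> M. 0 < b p q}" by auto
    ultimately show ?thesis by simp
  qed
  have pW: "p \<in> {q \<in> M. 0 < b p q}" if "p \<in> M" for p
    using that C(2)[OF that] R(1)[OF that] by (simp add: b_def chart_bump_def bump_pos)
  obtain D where D: "finite D" "D \<subseteq> M" "M \<subseteq> (\<Union>p\<in>D. {q \<in> M. 0 < b p q})"
  proof -
    have "M \<subseteq> (\<Union>p\<in>M. {q \<in> M. 0 < b p q})" using pW by blast
    then have "\<exists>D'. D' \<subseteq> (\<lambda>p. {q \<in> M. 0 < b p q}) ` M \<and> finite D' \<and> M \<subseteq> \<Union>D'"
      using compact_M[unfolded compact_eq_openin_cover, rule_format, of "(\<lambda>p. {q \<in> M. 0 < b p q}) ` M"] W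
      by auto
    then obtain D' where D': "D' \<subseteq> (\<lambda>p. {q \<in> M. 0 < b p q}) ` M" "finite D'" "M \<subseteq> \<Union>D'" by blast
    obtain D where "D \<subseteq> M" "finite D" "D' = (\<lambda>p. {q \<in> M. 0 < b p q}) ` D"
      using finite_subset_image[OF D'(2,1)] by blast
    then show ?thesis using D'(3) by (intro that[of D]) auto
  qed
  \<comment> \<open>The base point is kept in the index because different points may select the same chart and ball.\<close>
  define I where "I = (\<lambda>p. (p, C p, K p)) ` D"
  define \<sigma> where "\<sigma> q = (\<Sum>p\<in>D. b p q)" for q
  define \<phi> where "\<phi> = (\<lambda>(p, c :: ('a, 'n) chart, K :: (real^'n) set) q. b p q / \<sigma> q)"
  have \<sigma>_pos: "\<sigma> q > 0" if q: "q \<in> M" for q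
  proof -
    obtain p where "p \<in> D" "0 < b p q" using D(3) q by auto
    then show ?thesis unfolding \<sigma>_def by (intro sum_pos2[OF D(1)]) (auto simp: b_nonneg)
  qed
  have bC: "Ck_function 1 (b p)" and bS: "supported_in (C p) (K p) (b p)" if "p \<in> D" for p
    using bs D(2) that by blast+
  have \<sigma>C: "Ck_function 1 \<sigma>"
    unfolding \<sigma>_def[abs_def] by (intro Ck_function_sum bC)
  show ?thesis
  proof (rule that[of I \<phi>])
    show "finite I" using D by (simp add: I_def)
    show "Ck_function 1 (\<phi> i)" if "i \<in> I" for i
    proof -
      obtain p where p: "p \<in> D" "i = (p, C p, K p)" using \<open>i \<in> I\<close> by (auto simp: I_def)
      show ?thesis unfolding p(2) \<phi>_def prod.case
        by (rule Ck_function_divide[OF bC[OF p(1)] \<sigma>C]) (use \<sigma>_pos in force)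
    qed
    show "supported_in c K' (\<phi> (p, c, K'))" if "(p, c, K') \<in> I" for p c K'
      using that bS by (auto simp: I_def \<phi>_def supported_in_def)
    show "(\<Sum>i\<in>I. \<phi> i q) = 1" if "q \<in> M" for q
    proof -
      have "(\<Sum>i\<in>I. \<phi> i q) = (\<Sum>p\<in>D. b p q / \<sigma> q)"
        unfolding I_def by (subst sum.reindex) (auto simp: inj_on_def \<phi>_def)
      also have "\<dots> = 1" using \<sigma>_pos[OF that] by (simp add: sum_divide_distrib[symmetric] \<sigma>_def[symmetric])
      finally show ?thesis .
    qed
  qed
qed

lemma integrable_supported:
  assumes h: "Ck_function 0 h" and s: "supported_in c K h"
  shows "integrable vol h"
proof -
  have c: "c \<in> A" and K: "compact K" "K \<subseteq> chart_img c"
    and h0: "\<And>p. p \<in> M \<Longrightarrow> p \<notin> chart_inv c ` K \<Longrightarrow> h p = 0"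
    using s by (auto simp: supported_in_def)
  have hU: "h p = 0" if "p \<in> M" "p \<notin> chart_dom c" for p
    using h0[OF that(1)] that(2) chart_inv_image_subset[OF c K(2)] by blast
  let ?F = "\<lambda>x. indicator (chart_img c) x *\<^sub>R (density_in c x * h (chart_inv c x))"
  have F0: "?F x = 0" if "x \<notin> K" for x
  proof (cases "x \<in> chart_img c")
    case True
    have "chart_inv c x \<notin> chart_inv c ` K"
      by (rule chart_inv_notin_image[OF c K(2) True that])
    then show ?thesis using h0 chart_inv_in_M[OF c True] by simp
  qed simp
  have "Ck_on 0 (chart_img c) (\<lambda>x. density_in c x * h (chart_inv c x))"
    using Ck_functionD[OF h c] density_continuous[OF c] by (auto intro!: continuous_on_mult simp: o_def)
  then have "Ck_on 0 (chart_img c) ?F"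
    by (rule iffD2[OF Ck_on_cong[OF open_chart_img[OF c]], rotated]) simp
  then have "Ck_on 0 UNIV ?F"
    by (rule Ck_on_extend_by_zero[OF open_chart_img[OF c] K]) (rule F0)
  then have "continuous_on UNIV ?F" by (simp only: Ck_on.simps)
  then have "integrable lborel ?F"
    by (rule integrable_compact_support[OF _ K(1)]) (rule F0)
  then show ?thesis
    using integral_in_chart(1)[OF c Ck_function_measurable[OF h] hU] by simp
qed

lemma Ck_function_integrable:
  assumes h: "Ck_function 0 h"
  shows "integrable vol h"
proof -
  obtain I :: "('a \<times> ('a, 'n) chart \<times> (real^'n) set) set" and \<phi> where
    P: "finite I" "\<And>i. i \<in> I \<Longrightarrow> Ck_function 1 (\<phi> i)"
    "\<And>p c K. (p, c, K) \<in> I \<Longrightarrow> supported_in c K (\<phi> (p, c, K))"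
    "\<And>p. p \<in> M \<Longrightarrow> (\<Sum>i\<in>I. \<phi> i p) = 1" using partition_of_unity by metis
  have "integrable vol (\<lambda>p. h p * \<phi> i p)" if i: "i \<in> I" for i
  proof -
    obtain p c K where ie: "i = (p, c, K)" by (cases i)
    have "Ck_function 0 (\<phi> i)" using Ck_function_Suc_D[of 0] P(2)[OF i] by simp
    then show ?thesis
      using P(3)[of p c K] i ie
      by (intro integrable_supported[of _ c K] Ck_function_mult h) (auto simp: supported_in_def)
  qed
  then have "integrable vol (\<lambda>p. \<Sum>i\<in>I. h p * \<phi> i p)" by (rule Bochner_Integration.integrable_sum)
  moreover have "integrable vol (\<lambda>p. \<Sum>i\<in>I. h p * \<phi> i p) \<longleftrightarrow> integrable vol h"
    by (rule Bochner_Integration.integrable_cong) (simp_all add: P(4) flip: sum_distrib_left)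
  ultimately show ?thesis by simp
qed

text \<open>If \<open>h\<close> were positive at some point then a nonempty open set in a chart image would have measure
  zero for the positive density \<open>sqrt (det g)\<close>, hence would be negligible.\<close>

lemma integral_zero_imp_zero:
  assumes h: "Ck_function 0 h" and nn: "\<And>p. p \<in> M \<Longrightarrow> 0 \<le> h p" and int: "(\<integral>p. h p \<partial>vol) \<le> 0" and p: "p \<in> M"
  shows "h p = 0"
proof (rule ccontr)
  assume ne: "h p \<noteq> 0"
  obtain c where c: "c \<in> A" "p \<in> chart_dom c" using p M_eq by auto
  have [measurable]: "h \<in> borel_measurable vol" by (rule Ck_function_measurable[OF h])
  have "(\<integral>p. h p \<partial>vol) = 0"
    using int nn by (intro antisym Bochner_Integration.integral_nonneg) auto
  moreover have "AE p in vol. 0 \<le> h p" by (rule AE_I2) (simp add: nn)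
  ultimately have "AE p in vol. h p = 0"
    using integral_nonneg_eq_0_iff_AE[OF Ck_function_integrable[OF h]] by simp
  moreover have "{q \<in> space vol. h q \<noteq> 0} \<in> sets vol" by measurable
  ultimately have null: "{q \<in> M. h q \<noteq> 0} \<in> null_sets vol"
    by (auto simp: AE_iff_null_sets elim: eventually_mono)
  define W where "W = {q \<in> chart_dom c. h q \<noteq> 0}"
  let ?V = "chart_map c ` W"
  have WM: "W = chart_dom c \<inter> {q \<in> M. h q \<noteq> 0}"
    using chart_dom_subset[OF c(1)] by (auto simp: W_def)
  have dom: "chart_dom c \<in> sets vol"
    using chart_dom_borel[OF c(1)] chart_dom_subset[OF c(1)] by (simp add: borel_subset_M)
  have W: "W \<in> null_sets vol"
    unfolding WM using null_set_Int1[OF null dom] by (simp add: Int_commute)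
  have "openin (top_of_set M) (M \<inter> h -` (- {0}))"
    using Ck_function_continuous[OF h] by (intro continuous_openin_preimage_gen) auto
  moreover have "M \<inter> h -` (- {0}) = {q \<in> M. h q \<noteq> 0}" by auto
  ultimately have "open ?V" unfolding WM using open_chart_image_Int[OF c(1)] by simp
  have "chart_volume c W = 0"
    using is_volume_vol c(1) W unfolding is_volume_def by (auto simp: W_def null_sets_def)
  moreover have "(\<lambda>x. ennreal (density_in c x) * indicator ?V x) \<in> borel_measurable lborel"
  proof -
    have "?V \<subseteq> chart_img c" using c(1) by (auto simp: W_def)
    then have "density_in c \<in> borel_measurable (restrict_space borel ?V)"
      by (intro borel_measurable_continuous_on_restrict continuous_on_subset[OF density_continuous[OF c(1)]])
    then have "(\<lambda>x. density_in c x * indicator ?V x) \<in> borel_measurable borel"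
      using \<open>open ?V\<close> by (simp add: borel_measurable_restrict_space_iff mult.commute)
    then have "(\<lambda>x. ennreal (density_in c x * indicator ?V x)) \<in> borel_measurable lborel" by simp
    moreover have "ennreal (density_in c x * indicator ?V x) = ennreal (density_in c x) * indicator ?V x" for x
      by (simp add: indicator_def)
    ultimately show ?thesis by simp
  qed
  ultimately have "AE x in lborel. ennreal (density_in c x) * indicator ?V x = 0"
    unfolding chart_volume_def by (simp add: nn_integral_0_iff_AE)
  moreover have "density_in c x > 0" if "x \<in> ?V" for x
    using that metric_det_pos[OF c(1)] c(1) by (auto simp: W_def)
  ultimately have "AE x in lborel. x \<notin> ?V"
  proof (elim eventually_mono)
    fix x assume "ennreal (density_in c x) * indicator ?V x = 0"
      and pos: "\<And>x. x \<in> ?V \<Longrightarrow> density_in c x > 0"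
    then have "ennreal (density_in c x) = 0" if "x \<in> ?V" using that by simp
    then show "x \<notin> ?V" using pos[of x] ennreal_eq_0_iff[of "density_in c x"] by linarith
  qed
  then have "emeasure lborel ?V = 0"
    using AE_iff_measurable[of ?V lborel "\<lambda>x. x \<notin> ?V"] \<open>open ?V\<close> by simp
  then have "negligible ?V"
    using \<open>open ?V\<close> by (simp add: negligible_iff_null_sets null_sets_def)
  moreover have "?V \<noteq> {}" using c ne by (auto simp: W_def)
  ultimately show False using open_not_negligible[OF \<open>open ?V\<close>] by blast
qed

end

section \<open>The divergence theorem\<close>

context vector_field_on_manifold
begin

lemma vf_apply_zero:
  assumes W: "openin (top_of_set M) W" "p \<in> W" and h: "\<And>q. q \<in> W \<Longrightarrow> h q = 0"
  shows "vf_apply A X h p = 0"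
proof -
  have p: "p \<in> M" using W openin_imp_subset by blast
  define d where "d = chart_at A p"
  have d: "d \<in> A" "p \<in> chart_dom d" using chart_at_in[OF p] by (auto simp: d_def)
  have "partial i (h \<circ> chart_inv d) (chart_map d p) = partial i (\<lambda>x. 0) (chart_map d p)" for i
    by (rule partial_cong[OF open_chart_image_Int[OF d(1) W(1)]]) (use d W(2) h in auto)
  then show ?thesis by (simp add: vf_apply_def Let_def flip: d_def)
qed

text \<open>Multiplied by the density \<open>sqrt (det g)\<close>, the integrand is a sum of partial derivatives of
  compactly supported functions, so the integral vanishes term by term.\<close>

lemma divergence_theorem_supported:
  assumes h: "Ck_function 1 h" and s: "supported_in c K h"
  shows "(\<integral>p. vf_apply A X h p + h p * divergence p \<partial>vol) = 0"
proof -
  have c: "c \<in> A" and K: "compact K" "K \<subseteq> chart_img c"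
    and h0: "\<And>p. p \<in> M \<Longrightarrow> p \<notin> chart_inv c ` K \<Longrightarrow> h p = 0"
    using s by (auto simp: supported_in_def)
  let ?V = "chart_img c" and ?H = "\<lambda>p. vf_apply A X h p + h p * divergence p"
  let ?hc = "h \<circ> chart_inv c"
  note V = open_chart_img[OF c]
  have H0: "?H p = 0" if "p \<in> M" "p \<notin> chart_dom c" for p
  proof -
    have "p \<in> M - chart_inv c ` K" using that chart_inv_image_subset[OF c K(2)] by blast
    moreover from this have "vf_apply A X h p = 0"
      by (rule vf_apply_zero[OF openin_complement_support[OF c K]]) (use h0 in auto)
    ultimately show ?thesis using h0 by simp
  qed
  have H: "Ck_function 0 ?H"
    using h Ck_function_Suc_D[of 0 h]
    by (intro Ck_function_add Ck_function_vf_apply Ck_function_mult Ck_function_divergence) auto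
  have hc0: "?hc x = 0" if "x \<in> ?V" "x \<notin> K" for x
  proof -
    have "chart_inv c x \<notin> chart_inv c ` K"
      by (rule chart_inv_notin_image[OF c K(2) that])
    then show ?thesis using h0 chart_inv_in_M[OF c that(1)] by simp
  qed
  define F where "F i x = indicator ?V x * (density_in c x * X c x $ i * ?hc x)" for i x
  have F0: "F i x = 0" if "x \<notin> K" for i x
    using hc0[OF _ that] by (simp add: F_def indicator_def)
  have dens: "Ck_on k ?V (density_in c)" for k
    by (intro Ck_on_sqrt V metric_det_smooth[OF c]) (use metric_det_pos[OF c] in auto)
  have hc: "Ck_on 1 ?V ?hc" by (rule Ck_functionD[OF h c])
  have FC: "Ck_on 1 UNIV (F i)" for i
  proof (rule Ck_on_extend_by_zero[OF V K])
    have "Ck_on 1 ?V (\<lambda>x. density_in c x * X c x $ i * ?hc x)"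
      by (intro Ck_on_mult V dens X_smooth[OF c] hc)
    then show "Ck_on 1 ?V (F i)"
      by (rule iffD2[OF Ck_on_cong[OF V], rotated]) (simp add: F_def)
  qed (rule F0)
  have eq: "indicator ?V x *\<^sub>R (density_in c x * ?H (chart_inv c x)) = (\<Sum>i\<in>UNIV. partial i (F i) x)" for x
  proof (cases "x \<in> ?V")
    case False
    have oK: "open (- K)" using K(1) by (simp add: compact_imp_closed open_Compl)
    have "partial i (F i) x = partial i (\<lambda>x. 0) x" for i
      by (rule partial_cong[OF oK]) (use False K(2) F0 in auto)
    then show ?thesis using False by simp
  next
    case True
    have pos: "det (g c x) > 0" by (rule metric_det_pos[OF c True])
    have d1: "density_in c differentiable (at x)" and d2: "(\<lambda>y. X c y $ i) differentiable (at x)"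
      and d3: "?hc differentiable (at x)" and d4: "(\<lambda>y. det (g c y)) differentiable (at x)" for i
      using dens[of 1] X_smooth[OF c, of 1 i] hc metric_det_smooth[OF c, of 1] True by auto
    have pd: "partial i (density_in c) x = partial i (\<lambda>y. det (g c y)) x / (2 * density_in c x)" for i
    proof -
      have "((\<lambda>y. density_in c y) has_derivative
          (\<lambda>v. frechet_derivative (\<lambda>y. det (g c y)) (at x) v * (inverse (density_in c x) / 2))) (at x)"
        using d4 pos by (intro has_derivative_real_sqrt) (auto simp: frechet_derivative_works)
      from has_derivative_imp_partial[OF this, of i] show ?thesis
        by (simp add: partial_def field_simps)
    qed
    have pF: "partial i (F i) x = density_in c x * (X c x $ i * partial i ?hc x)
        + ?hc x * (density_in c x * partial i (\<lambda>y. X c y $ i) x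
           + X c x $ i * partial i (\<lambda>y. det (g c y)) x / (2 * density_in c x))" for i
    proof -
      have "partial i (F i) x = partial i (\<lambda>y. density_in c y * X c y $ i * ?hc y) x"
        by (rule partial_cong[OF V True]) (simp add: F_def)
      also have "\<dots> = density_in c x * X c x $ i * partial i ?hc x
          + (density_in c x * partial i (\<lambda>y. X c y $ i) x + partial i (density_in c) x * X c x $ i) * ?hc x"
        using d1 d2 d3 by (simp only: partial_mult differentiable_mult)
      finally show ?thesis unfolding pd by (simp add: algebra_simps)
    qed
    \<comment> \<open>This matches the determinant term of the divergence with the derivative of the square root in
      the density.\<close>
    have dd: "density_in c x * (S / (2 * det (g c x))) = S / (2 * density_in c x)" for S
      using pos real_sqrt_mult_self[of "det (g c x)"] by (simp add: field_simps)
    have "indicator ?V x *\<^sub>R (density_in c x * ?H (chart_inv c x))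
      = density_in c x * (\<Sum>i\<in>UNIV. X c x $ i * partial i ?hc x)
        + ?hc x * (density_in c x * (\<Sum>i\<in>UNIV. partial i (\<lambda>y. X c y $ i) x)
          + density_in c x * ((\<Sum>i\<in>UNIV. X c x $ i * partial i (\<lambda>y. det (g c y)) x) / (2 * det (g c x))))"
      using True vf_apply_in_chart[of 0 h c x] h c
      by (simp add: divergence_in_chart coord_divergence_def algebra_simps)
    also have "\<dots> = (\<Sum>i\<in>UNIV. partial i (F i) x)"
      unfolding dd pF by (simp add: sum.distrib sum_distrib_left sum_divide_distrib distrib_left)
    finally show ?thesis .
  qed
  have "(\<integral>p. ?H p \<partial>vol)
    = (\<integral>x. indicator ?V x *\<^sub>R (density_in c x * ?H (chart_inv c x)) \<partial>lborel)"
    by (rule integral_in_chart(2)[OF c Ck_function_measurable[OF H]]) (rule H0)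
  also have "\<dots> = (\<integral>x. (\<Sum>i\<in>UNIV. partial i (F i) x) \<partial>lborel)"
    by (simp only: eq)
  also have "\<dots> = (\<Sum>i\<in>UNIV. (\<integral>x. partial i (F i) x \<partial>lborel))"
    by (rule Bochner_Integration.integral_sum) (rule integral_partial_compact_support(1)[OF FC K(1) F0])
  also have "\<dots> = 0"
    using integral_partial_compact_support(2)[OF FC K(1) F0] by simp
  finally show ?thesis .
qed

text \<open>For a partition of unity \<open>\<phi>\<close>, both summands of the integrand are linear in \<open>h = (\<Sum>i. h \<phi>\<^sub>i)\<close>, and each
  \<open>h \<phi>\<^sub>i\<close> is supported in one chart.\<close>

theorem divergence_theorem:
  assumes h: "Ck_function 1 h"
  shows "(\<integral>p. vf_apply A X h p + h p * divergence p \<partial>vol) = 0"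
proof -
  obtain I :: "('a \<times> ('a, 'n) chart \<times> (real^'n) set) set" and \<phi> where
    P: "finite I" "\<And>i. i \<in> I \<Longrightarrow> Ck_function 1 (\<phi> i)"
    "\<And>p c K. (p, c, K) \<in> I \<Longrightarrow> supported_in c K (\<phi> (p, c, K))"
    "\<And>p. p \<in> M \<Longrightarrow> (\<Sum>i\<in>I. \<phi> i p) = 1" using partition_of_unity by metis
  let ?h = "\<lambda>i p. h p * \<phi> i p"
  have hi: "Ck_function 1 (?h i)" if "i \<in> I" for i by (intro Ck_function_mult h P(2) that)
  have sum: "(\<Sum>i\<in>I. ?h i p) = h p" if "p \<in> M" for p
    using P(4)[OF that] by (simp flip: sum_distrib_left)
  have vf_sum: "vf_apply A X h p = (\<Sum>i\<in>I. vf_apply A X (?h i) p)" if p: "p \<in> M" for p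
  proof -
    define d x where "d = chart_at A p" and "x = chart_map d p"
    have d: "d \<in> A" "p \<in> chart_dom d" using chart_at_in[OF p] by (auto simp: d_def)
    have x: "x \<in> chart_img d" using d by (simp add: x_def)
    have "partial j (h \<circ> chart_inv d) x = (\<Sum>i\<in>I. partial j (?h i \<circ> chart_inv d) x)" for j
    proof -
      have "partial j (h \<circ> chart_inv d) x = partial j (\<lambda>y. \<Sum>i\<in>I. (?h i \<circ> chart_inv d) y) x"
        by (rule partial_cong[OF open_chart_img[OF d(1)] x]) (simp add: sum chart_inv_in_M[OF d(1)])
      also have "\<dots> = (\<Sum>i\<in>I. partial j (?h i \<circ> chart_inv d) x)"
        by (rule partial_sum, rule Ck_function_differentiable[OF _ d(1) x, of 0])
          (use hi in simp)
      finally show ?thesis .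
    qed
    then have "vf_apply A X h p = (\<Sum>j\<in>UNIV. \<Sum>i\<in>I. X d x $ j * partial j (?h i \<circ> chart_inv d) x)"
      by (simp add: vf_apply_def Let_def sum_distrib_left flip: d_def x_def)
    also have "\<dots> = (\<Sum>i\<in>I. vf_apply A X (?h i) p)"
      by (subst sum.swap) (simp add: vf_apply_def Let_def flip: d_def x_def)
    finally show ?thesis .
  qed
  have "(\<integral>p. vf_apply A X h p + h p * divergence p \<partial>vol)
    = (\<integral>p. (\<Sum>i\<in>I. vf_apply A X (?h i) p + ?h i p * divergence p) \<partial>vol)"
    by (rule Bochner_Integration.integral_cong)
      (simp_all add: vf_sum sum.distrib sum flip: sum_distrib_right)
  also have "\<dots> = (\<Sum>i\<in>I. (\<integral>p. vf_apply A X (?h i) p + ?h i p * divergence p \<partial>vol))"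
  proof (rule Bochner_Integration.integral_sum, rule Ck_function_integrable)
    fix i assume "i \<in> I"
    then show "Ck_function 0 (\<lambda>p. vf_apply A X (?h i) p + ?h i p * divergence p)"
      using hi Ck_function_Suc_D[of 0 "?h i"]
      by (intro Ck_function_add Ck_function_vf_apply Ck_function_mult[of 0 "?h i"] Ck_function_divergence) auto
  qed
  also have "\<dots> = 0"
  proof (rule sum.neutral, rule ballI)
    fix i assume i: "i \<in> I"
    obtain p c K where ie: "i = (p, c, K)" by (cases i)
    have "supported_in c K (?h i)"
      using P(3)[of p c K] i ie by (auto simp: supported_in_def)
    then show "(\<integral>p. vf_apply A X (?h i) p + ?h i p * divergence p \<partial>vol) = 0"
      by (rule divergence_theorem_supported[OF hi[OF i]])
  qed
  finally show ?thesis .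
qed

end

section \<open>Gradient Ricci solitons\<close>

theorem theorem1:
  fixes M :: "'a::{t2_space,second_countable_topology} set"
    and A :: "('a, 'n::finite) chart set"
    and g :: "('a, 'n) tensor2"
    and f :: "'a \<Rightarrow> real"
    and lam :: real
  assumes "closed_manifold M A"
    and "gradient_ricci_soliton M A g f lam"
    and "(\<integral>p. vf_apply A (gradient g f) (scalar_curvature A g) p \<partial>riemannian_volume M A g) \<le> 0"
  shows "einstein_soliton M A g (gradient g f) lam"
proof -
  let ?\<xi> = "gradient g f" and ?s = "scalar_curvature A g"
  have sol: "ricci_soliton M A g ?\<xi> lam" and f: "smooth_function A f"
    using assms(2) by (auto simp: gradient_ricci_soliton_def)
  interpret vector_field_on_manifold M A g ?\<xi>
    using assms(1) sol by unfold_locales (auto simp: ricci_soliton_def)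
  let ?u = divergence
  have fC: "Ck_function k f" for k using f by (simp add: Ck_function_def smooth_function_def smooth_on_def)

  \<comment> \<open>Contract the soliton equation with the inverse metric.\<close>
  have s: "coord_scalar_curvature (g c) x = - coord_divergence (?\<xi> c) (g c) x - lam * real CARD('n)"
    if c: "c \<in> A" and x: "x \<in> chart_img c" for c x
  proof -
    let ?N = "matrix_inv (g c x)" and ?L = "lie_derivative (?\<xi> c) (g c) x"
    have eq: "- ricci (g c) x = (1/2) *\<^sub>R ?L + lam *\<^sub>R g c x"
      using sol c x by (auto simp: ricci_soliton_def)
    have ric: "ricci (g c) x $ j $ k = - (1/2) * ?L $ j $ k - lam * g c x $ j $ k" for j k
      using arg_cong[OF eq, of "\<lambda>A. A $ j $ k"] by simp
    have "coord_scalar_curvature (g c) x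
      = - (1/2) * (\<Sum>j\<in>UNIV. \<Sum>k\<in>UNIV. ?N $ j $ k * ?L $ j $ k)
        - lam * (\<Sum>j\<in>UNIV. \<Sum>k\<in>UNIV. ?N $ j $ k * g c x $ j $ k)"
      unfolding coord_scalar_curvature_def ric
      by (simp add: algebra_simps sum_subtractf sum_distrib_left sum_negf)
    also have "(\<Sum>j\<in>UNIV. \<Sum>k\<in>UNIV. ?N $ j $ k * g c x $ j $ k) = real CARD('n)"
      by (rule trace_inverse_self[OF metric_invertible[OF c x] metric_sym[OF c x]])
    also have "(\<Sum>j\<in>UNIV. \<Sum>k\<in>UNIV. ?N $ j $ k * ?L $ j $ k) = 2 * coord_divergence (?\<xi> c) (g c) x"
    proof (rule trace_lie_derivative)
      show "invertible (g c x)" "transpose (g c x) = g c x"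
        using metric_invertible[OF c x] metric_sym[OF c x] .
      show "(\<lambda>x. g c x $ a $ b) differentiable (at x)" for a b
        using metric_smooth[OF c, of 1 a b] x by simp
    qed
    finally show ?thesis by simp
  qed
  have s_u: "?s p = - ?u p - lam * real CARD('n)" if p: "p \<in> M" for p
    using s chart_at_in[OF p] by (simp add: scalar_curvature_def divergence_def Let_def)
  have xi_s: "vf_apply A ?\<xi> ?s p = - vf_apply A ?\<xi> ?u p" if p: "p \<in> M" for p
  proof -
    define d x where "d = chart_at A p" and "x = chart_map d p"
    have d: "d \<in> A" "p \<in> chart_dom d" using chart_at_in[OF p] by (auto simp: d_def)
    have x: "x \<in> chart_img d" using d by (simp add: x_def)
    have du: "(?u \<circ> chart_inv d) differentiable (at x)"
      by (rule Ck_function_differentiable[OF Ck_function_divergence d(1) x])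
    have "partial j (?s \<circ> chart_inv d) x = - partial j (?u \<circ> chart_inv d) x" for j
    proof -
      have "partial j (?s \<circ> chart_inv d) x
        = partial j (\<lambda>y. - 1 * (?u \<circ> chart_inv d) y + - (lam * real CARD('n))) x"
        by (rule partial_cong[OF open_chart_img[OF d(1)] x]) (simp add: s_u chart_inv_in_M[OF d(1)])
      also have "\<dots> = - partial j (?u \<circ> chart_inv d) x"
        using du by (subst partial_add, simp_all only: partial_mult differentiable_mult differentiable_const)
          (simp add: o_def)
      finally show ?thesis .
    qed
    then show ?thesis by (simp add: vf_apply_def Let_def sum_negf flip: d_def x_def)
  qed

  have uC: "Ck_function k ?u" for k by (rule Ck_function_divergence)
  have xuC: "Ck_function 0 (vf_apply A ?\<xi> ?u)" by (rule Ck_function_vf_apply[OF uC])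
  have uuC: "Ck_function 0 (\<lambda>p. ?u p * ?u p)" by (intro Ck_function_mult uC)
  \<comment> \<open>The divergence theorem for \<open>u \<xi>\<close>.\<close>
  have "(\<integral>p. ?u p * ?u p \<partial>vol) = - (\<integral>p. vf_apply A ?\<xi> ?u p \<partial>vol)"
    using divergence_theorem[OF uC] Ck_function_integrable[OF xuC] Ck_function_integrable[OF uuC] by simp
  also have "\<dots> = (\<integral>p. vf_apply A ?\<xi> ?s p \<partial>vol)"
  proof -
    have "(\<integral>p. vf_apply A ?\<xi> ?s p \<partial>vol) = (\<integral>p. - vf_apply A ?\<xi> ?u p \<partial>vol)"
      by (rule Bochner_Integration.integral_cong) (simp_all add: xi_s)
    then show ?thesis by simp
  qed
  finally have "(\<integral>p. ?u p * ?u p \<partial>vol) \<le> 0" using assms(3) by simp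
  then have u0: "?u p = 0" if "p \<in> M" for p
    using integral_zero_imp_zero[OF uuC _ _ that] by simp

  \<comment> \<open>Here the field is the gradient: \<open>\<xi>(f) = |\<xi>|\<^sup>2\<close>.\<close>
  have xf: "vf_apply A ?\<xi> f (chart_inv c x) = ?\<xi> c x \<bullet> (g c x *v ?\<xi> c x)"
    if c: "c \<in> A" and x: "x \<in> chart_img c" for c x
  proof -
    have "g c x *v ?\<xi> c x = (\<chi> i. partial i (f \<circ> chart_inv c) x)"
      using matrix_inv_inverse(1)[OF metric_invertible[OF c x]]
      by (simp add: gradient_def matrix_vector_mul_assoc)
    then show ?thesis using vf_apply_in_chart[OF fC c x] by (simp add: inner_vec_def)
  qed
  have xf_nonneg: "0 \<le> vf_apply A ?\<xi> f p" if p: "p \<in> M" for p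
  proof -
    obtain c where c: "c \<in> A" "p \<in> chart_dom c" using p M_eq by auto
    show ?thesis
      using xf[OF c(1), of "chart_map c p"] metric_pos[OF c(1), of "chart_map c p" "?\<xi> c (chart_map c p)"] c
      by (cases "?\<xi> c (chart_map c p) = 0") auto
  qed
  \<comment> \<open>The divergence theorem for \<open>f \<xi>\<close>, whose divergence is \<open>\<xi>(f)\<close> now that \<open>u\<close> vanishes.\<close>
  have "(\<integral>p. vf_apply A ?\<xi> f p \<partial>vol) = (\<integral>p. vf_apply A ?\<xi> f p + f p * ?u p \<partial>vol)"
    by (rule Bochner_Integration.integral_cong) (simp_all add: u0)
  then have "(\<integral>p. vf_apply A ?\<xi> f p \<partial>vol) \<le> 0" using divergence_theorem[OF fC] by simp
  then have xf0: "vf_apply A ?\<xi> f p = 0" if "p \<in> M" for p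
    using integral_zero_imp_zero[OF Ck_function_vf_apply[OF fC] xf_nonneg _ that] by blast
  have xi0: "?\<xi> c x = 0" if c: "c \<in> A" and x: "x \<in> chart_img c" for c x
    using xf[OF c x] xf0[OF chart_inv_in_M[OF c x]] metric_pos[OF c x, of "?\<xi> c x"] by fastforce
  have "lie_derivative (?\<xi> c) (g c) x = 0" if c: "c \<in> A" and x: "x \<in> chart_img c" for c x
  proof -
    have "partial i (\<lambda>y. ?\<xi> c y $ k) x = partial i (\<lambda>y. 0) x" for i k
      by (rule partial_cong[OF open_chart_img[OF c] x]) (simp add: xi0[OF c])
    then show ?thesis by (simp add: lie_derivative_def xi0[OF c x] vec_eq_iff)
  qed
  then show ?thesis using sol by (simp add: einstein_soliton_def)
qed

end
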